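(* There exists a universal constant $C>0$ such that for every $0<\epsilon<1$, every integer $h \ge 16$, and every even integer $n \ge (C\sqrt{h}/\epsilon)^h$, there exists a nice graph on $n$ vertices with independence number at most $2n e^{-\epsilon\sqrt{h}/4}$ and minimum degree at least $\left(\frac14 - 2\epsilon\right) n$.
   Context: A graph $G=(V,E)$ on $n$ vertices is called nice if it is $K_4$-free and there is a partition $V = X \cup Y$ into two parts each of size $n/2$ such that each of the induced subgraphs $G[X]$ and $G[Y]$ is triangle-free. *)

theory Defs
  imports Complex_Main "HOL-Library.Ramsey"
begin

text \<open>Edges are two-element vertex sets, as expected by \<^const>\<open>clique\<close> and \<^const>\<open>indep\<close>.\<close>

definition simple_graph :: "'a set \<Rightarrow> 'a set set \<Rightarrow> bool" where
  "simple_graph V E \<longleftrightarrow> finite V \<and> E \<subseteq> [V]\<^bsup>2\<^esup>"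

definition induced_edges :: "'a set set \<Rightarrow> 'a set \<Rightarrow> 'a set set" where
  "induced_edges E X = E \<inter> [X]\<^bsup>2\<^esup>"

definition clique_free :: "nat \<Rightarrow> 'a set \<Rightarrow> 'a set set \<Rightarrow> bool" where
  "clique_free r V E \<longleftrightarrow> \<not> (\<exists>K \<in> [V]\<^bsup>r\<^esup>. clique K E)"

definition independence_number :: "'a set \<Rightarrow> 'a set set \<Rightarrow> nat" where
  "independence_number V E = Max (card ` {S. S \<subseteq> V \<and> indep S E})"

definition vertex_degree :: "'a set set \<Rightarrow> 'a \<Rightarrow> nat" where
  "vertex_degree E v = card {e \<in> E. v \<in> e}"

text \<open>Only meaningful for a finite nonempty vertex set.\<close>

definition min_degree :: "'a set \<Rightarrow> 'a set set \<Rightarrow> nat" where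
  "min_degree V E = Min (vertex_degree E ` V)"

definition nice_graph :: "'a set \<Rightarrow> 'a set set \<Rightarrow> bool" where
  "nice_graph V E \<longleftrightarrow>
     simple_graph V E \<and> clique_free 4 V E \<and>
     (\<exists>X Y. X \<union> Y = V \<and> X \<inter> Y = {} \<and>
        real (card X) = real (card V) / 2 \<and> real (card Y) = real (card V) / 2 \<and>
        clique_free 3 X (induced_edges E X) \<and> clique_free 3 Y (induced_edges E Y))"

end

theory Submission
  imports Defs "HOL-Analysis.L2_Norm" "HOL-Analysis.Harmonic_Numbers" "HOL-Library.FuncSet"
begin

text \<open>
  A Bollobas--Erdos graph is built on the integer points of a Euclidean ball of radius \<open>r\<close> in dimension
  \<open>h\<close> instead of a sphere. With \<open>\<mu> = \<epsilon> / \<surd>h\<close>, points on the same side are joined if their squared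
  distance exceeds \<open>4(1 - \<mu>)r\<^sup>2\<close>, points on different sides if it is below \<open>2(1 - \<mu>)r\<^sup>2\<close>; the
  quadrilateral inequality excludes \<open>K\<^sub>4\<close>.

  For an independent set \<open>A\<close> on one side, \<open>(A - A)/2\<close> lies in a ball of radius \<open>r \<surd>(1 - \<mu>)\<close>, so a discrete
  Brunn--Minkowski inequality bounds \<open>A\<close> by about \<open>(1 - \<mu>)\<^bsup>h/2\<^esup>\<close> of the ball. A point \<open>x\<close> is joined to
  half of the other side up to the slab of points nearly orthogonal to \<open>x\<close>, and this slab is small
  because it has about \<open>1/\<epsilon>\<close> disjoint translates in a ball that is only slightly larger.
  The radius is chosen extremally, so that the number of lattice points near it grows as the volume does.
  Finally the vertices are distributed evenly over the lattice points.
\<close>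

section \<open>Discrete Brunn--Minkowski inequality\<close>

text \<open>Every element of \<open>I + Min J\<close> is at most \<open>Max I + Min J\<close>, and
  every element of \<open>Max I + J + 1\<close> is larger, so these two copies are disjoint. The
  extra bit \<open>e\<close> gains the one point by which integer sumsets fall short of
  \<open>card I + card J\<close>.\<close>

lemma card_int_sumset_ge:
  fixes I J D :: "int set"
  assumes "finite I" "finite J" "I \<noteq> {}" "J \<noteq> {}" "finite D"
    and sub: "\<And>i j e. i \<in> I \<Longrightarrow> j \<in> J \<Longrightarrow> e \<in> {0,1} \<Longrightarrow> i + j + e \<in> D"
  shows "card I + card J \<le> card D"
proof -
  let ?P = "(\<lambda>i. i + Min J) ` I" and ?Q = "(\<lambda>j. Max I + j + 1) ` J"
  have "Min J \<in> J" "Max I \<in> I" using assms by auto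
  then have "?P \<union> ?Q \<subseteq> D" using sub[where e=0] sub[where e=1] by force
  moreover have "?P \<inter> ?Q = {}"
  proof -
    have "i + Min J \<noteq> Max I + j + 1" if "i \<in> I" "j \<in> J" for i j
      using Max_ge[OF assms(1) that(1)] Min_le[OF assms(2) that(2)] by linarith
    then show ?thesis by blast
  qed
  moreover have "card ?P = card I" "card ?Q = card J"
    by (auto intro!: card_image inj_onI)
  ultimately show ?thesis
    using card_Un_disjoint[of ?P ?Q] card_mono[OF \<open>finite D\<close>, of "?P \<union> ?Q"] assms by simp
qed

text \<open>A layer-cake argument: \<open>card_int_sumset_ge\<close> is applied to the superlevel
  sets of \<open>F\<close> and \<open>G\<close>, peeling off the lowest value at each induction
  step. The common attained maximum \<open>M\<close> keeps both superlevel sets nonempty at every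
  level below \<open>M\<close>.\<close>

lemma sum_le_sum_of_min_le:
  fixes F G K :: "int \<Rightarrow> real"
  assumes "finite I" "finite J" "finite D"
    and "i0 \<in> I" "F i0 = M" "j0 \<in> J" "G j0 = M"
    and "\<And>i. i \<in> I \<Longrightarrow> 0 \<le> F i \<and> F i \<le> M" "\<And>j. j \<in> J \<Longrightarrow> 0 \<le> G j \<and> G j \<le> M"
    and "\<And>k. k \<in> D \<Longrightarrow> 0 \<le> K k"
    and "\<And>i j e. i \<in> I \<Longrightarrow> j \<in> J \<Longrightarrow> e \<in> {0,1} \<Longrightarrow> i + j + e \<in> D \<and> min (F i) (G j) \<le> K (i + j + e)"
  shows "sum F I + sum G J \<le> sum K D"
  using assms
proof (induction "card I + card J" arbitrary: I J D F G K M rule: less_induct)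
  case less
  define c where "c = Min (F ` I \<union> G ` J)"
  have fin: "finite (F ` I \<union> G ` J)" using less.prems by simp
  have c_mem: "c \<in> F ` I \<union> G ` J"
    unfolding c_def using fin less.prems(4) by (intro Min_in) auto
  have cF: "c \<le> F i" if "i \<in> I" for i unfolding c_def using fin that by (intro Min_le) auto
  have cG: "c \<le> G j" if "j \<in> J" for j unfolding c_def using fin that by (intro Min_le) auto
  have c0: "0 \<le> c" using c_mem less.prems(8,9) by auto
  have cM: "c \<le> M" using cF less.prems(4,5) by auto
  define I' where "I' = {i \<in> I. c < F i}"
  define J' where "J' = {j \<in> J. c < G j}"
  \<comment> \<open>On all of \<open>D\<close> the function \<open>K - c\<close> may be negative. On
    the sums actually reached it is not, so the induction hypothesis can be applied with
    \<open>D1\<close> as target.\<close>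
  define D1 where "D1 = (\<lambda>(i,j,e). i + j + e) ` (I \<times> J \<times> {0,1})"
  have D1: "D1 \<subseteq> D" unfolding D1_def using less.prems(11) by force
  have finD1: "finite D1" unfolding D1_def using less.prems(1,2) by simp
  have card: "card I + card J \<le> card D1"
  proof (rule card_int_sumset_ge[OF less.prems(1,2) _ _ finD1])
    show "i + j + e \<in> D1" if "i \<in> I" "j \<in> J" "e \<in> {0, 1}" for i j e
      unfolding D1_def using that by (intro image_eqI[of _ _ "(i, j, e)"]) auto
  qed (use less.prems in auto)
  have KD1: "c \<le> K k" if k: "k \<in> D1" for k
  proof -
    obtain i j e where "i \<in> I" "j \<in> J" "e \<in> {0,1}" "k = i + j + e"
      using k unfolding D1_def by auto
    then show ?thesis using less.prems(11)[of i j e] cF[of i] cG[of j] by auto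
  qed
  have sK: "sum K D1 \<le> sum K D" using D1 less.prems(3,10) by (intro sum_mono2) auto
  have sF: "sum F I = (\<Sum>i\<in>I'. F i - c) + c * card I"
  proof -
    have "(\<Sum>i\<in>I'. F i - c) = (\<Sum>i\<in>I. F i - c)"
      by (rule sum.mono_neutral_left) (use less.prems(1) cF in \<open>auto simp: I'_def less_le\<close>)
    then show ?thesis by (simp add: sum_subtractf)
  qed
  have sG: "sum G J = (\<Sum>j\<in>J'. G j - c) + c * card J"
  proof -
    have "(\<Sum>i\<in>J'. G i - c) = (\<Sum>i\<in>J. G i - c)"
      by (rule sum.mono_neutral_left) (use less.prems(2) cG in \<open>auto simp: J'_def less_le\<close>)
    then show ?thesis by (simp add: sum_subtractf)
  qed
  have sK1: "sum K D1 = (\<Sum>k\<in>D1. K k - c) + c * card D1" by (simp add: sum_subtractf)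
  have "(\<Sum>i\<in>I'. F i - c) + (\<Sum>j\<in>J'. G j - c) \<le> (\<Sum>k\<in>D1. K k - c)"
  proof (cases "c = M")
    \<comment> \<open>When the lowest value is already the maximum, no index survives and the
      induction hypothesis, which needs attained maxima, does not apply.\<close>
    case True
    then have "I' = {}" "J' = {}" unfolding I'_def J'_def using less.prems(8,9) by force+
    then show ?thesis using KD1 by (simp add: sum_nonneg)
  next
    case False
    then have "c < M" using cM by simp
    \<comment> \<open>An index at which \<open>c\<close> is attained drops out, so the induction
      measure decreases.\<close>
    have "I' \<subset> I \<or> J' \<subset> J" using c_mem unfolding I'_def J'_def by auto
    moreover have "I' \<subseteq> I" "J' \<subseteq> J" unfolding I'_def J'_def by auto
    ultimately have lt: "card I' + card J' < card I + card J"
      using psubset_card_mono[of I I'] psubset_card_mono[of J J'] card_mono[of I I'] card_mono[of J J']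
        less.prems(1,2) by linarith
    show ?thesis
    proof (rule less.hyps[OF lt, where M = "M - c"])
      show "finite I'" "finite J'" "finite D1" using less.prems finD1 by (auto simp: I'_def J'_def)
      show "i0 \<in> I'" "j0 \<in> J'" using less.prems \<open>c < M\<close> by (auto simp: I'_def J'_def)
      show "F i0 - c = M - c" "G j0 - c = M - c" using less.prems by auto
      fix i j e assume ije: "i \<in> I'" "j \<in> J'" "e \<in> {0::int,1}"
      then have ij: "i \<in> I" "j \<in> J" by (auto simp: I'_def J'_def)
      show "i + j + e \<in> D1 \<and> min (F i - c) (G j - c) \<le> K (i + j + e) - c"
        using less.prems(11)[OF ij ije(3)] ij ije(3) unfolding D1_def
        by (auto intro!: image_eqI[of _ _ "(i, j, e)"])
    qed (use less.prems KD1 in \<open>auto simp: I'_def J'_def\<close>)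
  qed
  moreover have "c * (real (card I) + real (card J)) \<le> c * card D1"
    using card c0 by (intro mult_left_mono) auto
  ultimately show ?case using sK sF sG sK1 by (simp add: algebra_simps)
qed

text \<open>Dividing \<open>F\<close> and \<open>G\<close> by their maxima and \<open>K\<close> by
  the geometric mean of these maxima reduces to \<open>sum_le_sum_of_min_le\<close> with
  \<open>M = 1\<close>, because the square of a minimum is at most the product. The factor 4 comes
  from \<open>4 * (x * y) \<le> (x + y)\<^sup>2\<close>.\<close>

lemma prekopa_leindler_int:
  fixes F G K :: "int \<Rightarrow> real"
  assumes fin: "finite I" "finite J" "finite D"
    and F0: "\<And>i. i \<in> I \<Longrightarrow> 0 \<le> F i" and G0: "\<And>j. j \<in> J \<Longrightarrow> 0 \<le> G j" and K0: "\<And>k. k \<in> D \<Longrightarrow> 0 \<le> K k"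
    and K: "\<And>i j e. i \<in> I \<Longrightarrow> j \<in> J \<Longrightarrow> e \<in> {0,1} \<Longrightarrow>
      i + j + e \<in> D \<and> F i * G j \<le> (K (i + j + e))\<^sup>2"
  shows "4 * (sum F I * sum G J) \<le> (sum K D)\<^sup>2"
proof (cases "sum F I = 0 \<or> sum G J = 0")
  case True
  then show ?thesis by auto
next
  case False
  define \<alpha> where "\<alpha> = Max (F ` I)"
  define \<beta> where "\<beta> = Max (G ` J)"
  have ne: "I \<noteq> {}" "J \<noteq> {}" using False by auto
  have Fa: "F i \<le> \<alpha>" if "i \<in> I" for i unfolding \<alpha>_def using that fin by simp
  have Gb: "G j \<le> \<beta>" if "j \<in> J" for j unfolding \<beta>_def using that fin by simp
  have "\<alpha> \<in> F ` I" unfolding \<alpha>_def using ne fin by (intro Max_in) auto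
  then obtain i0 where i0: "i0 \<in> I" "F i0 = \<alpha>" by auto
  have "\<beta> \<in> G ` J" unfolding \<beta>_def using ne fin by (intro Max_in) auto
  then obtain j0 where j0: "j0 \<in> J" "G j0 = \<beta>" by auto
  have "\<alpha> \<noteq> 0"
  proof
    assume "\<alpha> = 0"
    then have "sum F I = 0" using Fa F0 by (intro sum.neutral) force
    then show False using False by simp
  qed
  then have a: "0 < \<alpha>" using F0 i0 by force
  have "\<beta> \<noteq> 0"
  proof
    assume "\<beta> = 0"
    then have "sum G J = 0" using Gb G0 by (intro sum.neutral) force
    then show False using False by simp
  qed
  then have b: "0 < \<beta>" using G0 j0 by force
  define s where "s = sqrt (\<alpha> * \<beta>)"
  have s: "0 < s" "s\<^sup>2 = \<alpha> * \<beta>" unfolding s_def using a b by auto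
  have main: "(\<Sum>i\<in>I. F i / \<alpha>) + (\<Sum>j\<in>J. G j / \<beta>) \<le> (\<Sum>k\<in>D. K k / s)"
  proof (rule sum_le_sum_of_min_le[where M = 1])
    show "i0 \<in> I" "j0 \<in> J" "F i0 / \<alpha> = 1" "G j0 / \<beta> = 1" using i0 j0 a b by auto
    fix i j e assume ij: "i \<in> I" "j \<in> J" "e \<in> {0::int,1}"
    have k: "i + j + e \<in> D" "F i * G j \<le> (K (i + j + e))\<^sup>2" using K[OF ij] by auto
    define m where "m = min (F i / \<alpha>) (G j / \<beta>)"
    have m0: "0 \<le> m" unfolding m_def using F0 G0 ij a b by auto
    have "m\<^sup>2 \<le> (F i / \<alpha>) * (G j / \<beta>)"
      unfolding power2_eq_square by (rule mult_mono) (use m0 F0 ij a in \<open>auto simp: m_def\<close>)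
    also have "\<dots> = F i * G j / s\<^sup>2" using s by simp
    also have "\<dots> \<le> (K (i + j + e))\<^sup>2 / s\<^sup>2" using k by (intro divide_right_mono) auto
    also have "\<dots> = (K (i + j + e) / s)\<^sup>2" by (simp add: power_divide)
    finally have "m \<le> K (i + j + e) / s"
      by (rule power2_le_imp_le) (use K0 k s in auto)
    then show "i + j + e \<in> D \<and> min (F i / \<alpha>) (G j / \<beta>) \<le> K (i + j + e) / s"
      using k m_def by simp
  qed (use fin F0 G0 K0 Fa Gb a b s in auto)
  define x where "x = sum F I / \<alpha>"
  define y where "y = sum G J / \<beta>"
  have xy: "0 \<le> x" "0 \<le> y" unfolding x_def y_def using F0 G0 a b by (auto intro!: divide_nonneg_pos sum_nonneg)
  have "x + y \<le> sum K D / s" using main unfolding x_def y_def by (simp add: sum_divide_distrib)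
  then have "(x + y)\<^sup>2 \<le> (sum K D / s)\<^sup>2" using xy by (intro power_mono) auto
  moreover have "4 * (x * y) \<le> (x + y)\<^sup>2" using sum_squares_bound[of x y] by (simp add: power2_sum)
  ultimately have "4 * (x * y) \<le> (sum K D)\<^sup>2 / (\<alpha> * \<beta>)" using s by (simp add: power_divide)
  then show ?thesis unfolding x_def y_def using a b by (simp add: field_simps)
qed

text \<open>Padding with zeros keeps one type for all dimensions, so induction on \<open>h\<close>
  is possible, and makes equality of functions agree with equality of the first \<open>h\<close>
  coordinates.\<close>

definition int_vecs :: "nat \<Rightarrow> (nat \<Rightarrow> int) set" where
  "int_vecs h = {z. \<forall>i\<ge>h. z i = 0}"

definition bits :: "nat \<Rightarrow> (nat \<Rightarrow> int) set" where
  "bits h = {z \<in> int_vecs h. \<forall>i<h. z i \<in> {0, 1}}"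

definition sumset_bits :: "nat \<Rightarrow> (nat \<Rightarrow> int) set \<Rightarrow> (nat \<Rightarrow> int) set \<Rightarrow> (nat \<Rightarrow> int) set" where
  "sumset_bits h A B = (\<lambda>(a, b, e) i. a i + b i + e i) ` (A \<times> B \<times> bits h)"

lemma bits_eq_image_Pow: "bits h = (\<lambda>S i. of_bool (i \<in> S)) ` Pow {..<h}"
proof (intro equalityI subsetI)
  fix z assume z: "z \<in> bits h"
  have "z = (\<lambda>i. of_bool (i \<in> {i. i < h \<and> z i = 1}))"
  proof
    show "z i = of_bool (i \<in> {i. i < h \<and> z i = 1})" for i
      using z by (cases "i < h") (auto simp: bits_def int_vecs_def)
  qed
  then show "z \<in> (\<lambda>S i. of_bool (i \<in> S)) ` Pow {..<h}" by (rule image_eqI) auto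
qed (auto simp: bits_def int_vecs_def)

lemma finite_bits: "finite (bits h)"
  by (simp add: bits_eq_image_Pow)

lemma card_bits: "card (bits h) = 2 ^ h"
proof -
  have "inj_on (\<lambda>S i. of_bool (i \<in> S) :: int) (Pow {..<h})"
    by (intro inj_onI set_eqI) (auto simp: fun_eq_iff of_bool_eq_iff)
  then show ?thesis by (simp add: bits_eq_image_Pow card_image card_Pow)
qed

text \<open>A slice at height \<open>i\<close> of the last coordinate is stored with that coordinate
  reset to 0, so that it lives one dimension lower.\<close>

definition fiber :: "nat \<Rightarrow> (nat \<Rightarrow> int) set \<Rightarrow> int \<Rightarrow> (nat \<Rightarrow> int) set" where
  "fiber h A i = {a \<in> int_vecs h. a(h := i) \<in> A}"

lemma bij_betw_fiber:
  assumes "A \<subseteq> int_vecs (Suc h)"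
  shows "bij_betw (\<lambda>a. a(h := i)) (fiber h A i) {a \<in> A. a h = i}"
proof (rule bij_betwI[where g = "\<lambda>a. a(h := 0)"])
  show "(\<lambda>a. a(h := 0)) \<in> {a \<in> A. a h = i} \<rightarrow> fiber h A i"
    using assms by (auto simp: fiber_def int_vecs_def Suc_le_eq)
qed (auto simp: fiber_def int_vecs_def fun_eq_iff)

lemma finite_fiber:
  assumes "finite A" "A \<subseteq> int_vecs (Suc h)"
  shows "finite (fiber h A i)"
  using bij_betw_finite[OF bij_betw_fiber[OF assms(2)]] assms(1) by simp

lemma card_eq_sum_fiber:
  assumes "finite A" "A \<subseteq> int_vecs (Suc h)"
  shows "card A = (\<Sum>i\<in>(\<lambda>a. a h) ` A. card (fiber h A i))"
proof -
  have "card A = (\<Sum>i\<in>(\<lambda>a. a h) ` A. card {a \<in> A. a h = i})"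
    using sum.image_gen[OF assms(1), of "\<lambda>_. 1::nat" "\<lambda>a. a h"] by simp
  also have "\<dots> = (\<Sum>i\<in>(\<lambda>a. a h) ` A. card (fiber h A i))"
    using bij_betw_same_card[OF bij_betw_fiber[OF assms(2)]] by simp
  finally show ?thesis .
qed

text \<open>Adding the vertices of the unit cube makes up for the
  discreteness of the lattice.\<close>

lemma card_sumset_bits_ge:
  assumes "finite A" "finite B" "A \<subseteq> int_vecs h" "B \<subseteq> int_vecs h"
  shows "4 ^ h * (real (card A) * real (card B)) \<le> (real (card (sumset_bits h A B)))\<^sup>2"
  using assms
proof (induction h arbitrary: A B)
  case 0
  have l0: "int_vecs 0 = {\<lambda>_. 0}" by (auto simp: int_vecs_def)
  then have sub: "A \<subseteq> {\<lambda>_. 0}" "B \<subseteq> {\<lambda>_. 0}" using 0 by auto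
  show ?case
  proof (cases "A = {} \<or> B = {}")
    case False
    then have "A = {\<lambda>_. 0}" "B = {\<lambda>_. 0}" using sub by auto
    moreover have "bits 0 = {\<lambda>_. 0}" using l0 by (auto simp: bits_def)
    ultimately show ?thesis by (simp add: sumset_bits_def)
  qed auto
next
  case (Suc h)
  define D where "D = sumset_bits (Suc h) A B"
  have finD: "finite D" unfolding D_def sumset_bits_def using Suc.prems finite_bits by simp
  have p4: "((2::real) ^ h)\<^sup>2 = 4 ^ h" by (simp add: power2_eq_square flip: power_mult_distrib)
  have Dl: "D \<subseteq> int_vecs (Suc h)"
    using Suc.prems unfolding D_def sumset_bits_def bits_def int_vecs_def by fastforce
  \<comment> \<open>These are the hypotheses of \<open>prekopa_leindler_int\<close> for the fiber
    sizes. The bit \<open>e\<close> is the last coordinate of the cube vertex, the remaining bits go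
    into the induction hypothesis, and its factor \<open>4 ^ h\<close> becomes the division by
    \<open>2 ^ h\<close>.\<close>
  have key: "i + j + e \<in> (\<lambda>a. a h) ` D \<and> real (card (fiber h A i)) * real (card (fiber h B j))
      \<le> (real (card (fiber h D (i + j + e))) / 2 ^ h)\<^sup>2"
    if i: "i \<in> (\<lambda>a. a h) ` A" and j: "j \<in> (\<lambda>a. a h) ` B" and e: "e \<in> {0, 1}" for i j e
  proof
    obtain a b where ab: "a \<in> A" "b \<in> B" "a h = i" "b h = j" using i j by auto
    define c where "c = (\<lambda>k. if k = h then e else 0)"
    have c: "c \<in> bits (Suc h)" using e by (auto simp: c_def bits_def int_vecs_def)
    then have "(\<lambda>k. a k + b k + c k) \<in> D"
      unfolding D_def sumset_bits_def using ab by (intro image_eqI[of _ _ "(a, b, c)"]) auto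
    then show "i + j + e \<in> (\<lambda>a. a h) ` D"
      by (rule rev_image_eqI) (use ab in \<open>simp add: c_def\<close>)
    have sub: "sumset_bits h (fiber h A i) (fiber h B j) \<subseteq> fiber h D (i + j + e)"
    proof
      fix z assume "z \<in> sumset_bits h (fiber h A i) (fiber h B j)"
      then obtain a b c where z: "a \<in> fiber h A i" "b \<in> fiber h B j" "c \<in> bits h"
          "z = (\<lambda>k. a k + b k + c k)"
        unfolding sumset_bits_def by auto
      have "c(h := e) \<in> bits (Suc h)" using z e by (auto simp: bits_def int_vecs_def)
      then have "(\<lambda>k. (a(h := i)) k + (b(h := j)) k + (c(h := e)) k) \<in> D"
        unfolding D_def sumset_bits_def using z
        by (intro image_eqI[of _ _ "(a(h := i), b(h := j), c(h := e))"]) (auto simp: fiber_def)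
      also have "(\<lambda>k. (a(h := i)) k + (b(h := j)) k + (c(h := e)) k) = z(h := i + j + e)"
        unfolding z(4) by (auto simp: fun_eq_iff)
      finally have "z(h := i + j + e) \<in> D" .
      then show "z \<in> fiber h D (i + j + e)"
        using z by (auto simp: fiber_def int_vecs_def bits_def)
    qed
    have "4 ^ h * (real (card (fiber h A i)) * real (card (fiber h B j)))
        \<le> (real (card (sumset_bits h (fiber h A i) (fiber h B j))))\<^sup>2"
      using Suc.prems by (intro Suc.IH finite_fiber) (auto simp: fiber_def)
    also have "\<dots> \<le> (real (card (fiber h D (i + j + e))))\<^sup>2"
      using card_mono[OF finite_fiber[OF finD Dl] sub] by simp
    finally show "real (card (fiber h A i)) * real (card (fiber h B j))
      \<le> (real (card (fiber h D (i + j + e))) / 2 ^ h)\<^sup>2"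
      by (simp add: power_divide p4 field_simps)
  qed
  have "4 * ((\<Sum>i\<in>(\<lambda>a. a h) ` A. real (card (fiber h A i))) * (\<Sum>i\<in>(\<lambda>a. a h) ` B. real (card (fiber h B i))))
      \<le> (\<Sum>i\<in>(\<lambda>a. a h) ` D. real (card (fiber h D i)) / 2 ^ h)\<^sup>2"
    by (rule prekopa_leindler_int) (use Suc.prems finD key in auto)
  also have "\<dots> = (real (card D))\<^sup>2 / 4 ^ h"
    using card_eq_sum_fiber[OF finD Dl]
    by (simp add: power_divide p4 flip: sum_divide_distrib)
  finally show ?case
    unfolding D_def[symmetric]
    using card_eq_sum_fiber[of A h] card_eq_sum_fiber[of B h] Suc.prems
    by (simp add: field_simps)
qed

section \<open>Lattice points in balls\<close>

definition vnorm :: "nat \<Rightarrow> (nat \<Rightarrow> int) \<Rightarrow> real" where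
  "vnorm h z = L2_set (\<lambda>i. real_of_int (z i)) {..<h}"

definition lball :: "nat \<Rightarrow> real \<Rightarrow> (nat \<Rightarrow> int) set" where
  "lball h r = {z \<in> int_vecs h. vnorm h z \<le> r}"

lemma vnorm_nonneg [simp]: "0 \<le> vnorm h z"
  by (simp add: vnorm_def)

lemma vnorm_sq: "(vnorm h z)\<^sup>2 = real_of_int (\<Sum>i<h. (z i)\<^sup>2)"
  by (simp add: vnorm_def L2_set_def sum_nonneg)

lemma vnorm_uminus: "vnorm h (\<lambda>i. - z i) = vnorm h z"
  by (simp add: vnorm_def L2_set_def)

lemma vnorm_add_le: "vnorm h (\<lambda>i. x i + y i) \<le> vnorm h x + vnorm h y"
  using L2_set_triangle_ineq[of "\<lambda>i. real_of_int (x i)" "\<lambda>i. real_of_int (y i)" "{..<h}"]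
  by (simp add: vnorm_def)

lemma vnorm_double: "vnorm h (\<lambda>i. 2 * z i) = 2 * vnorm h z"
  using L2_set_right_distrib[of 2 "\<lambda>i. real_of_int (z i)" "{..<h}"] by (simp add: vnorm_def)

lemma vnorm_bits:
  assumes "e \<in> bits h"
  shows "vnorm h e \<le> sqrt (real h)"
proof -
  have "vnorm h e \<le> L2_set (\<lambda>i. 1) {..<h}"
    unfolding vnorm_def using assms by (intro L2_set_mono) (auto simp: bits_def)
  then show ?thesis by (simp add: L2_set_constant)
qed

lemma abs_le_vnorm:
  assumes "i < h"
  shows "\<bar>real_of_int (z i)\<bar> \<le> vnorm h z"
proof -
  have "\<bar>real_of_int (z i)\<bar> \<le> L2_set (\<lambda>i. \<bar>real_of_int (z i)\<bar>) {..<h}"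
    using assms by (intro member_le_L2_set) auto
  then show ?thesis by (simp add: vnorm_def L2_set_def)
qed

lemma lball_subset_cube:
  "lball h r \<subseteq> {z. \<forall>i. (i \<in> {..<h} \<longrightarrow> z i \<in> {-\<lfloor>r\<rfloor>..\<lfloor>r\<rfloor>}) \<and> (i \<notin> {..<h} \<longrightarrow> z i = 0)}"
proof
  fix z assume z: "z \<in> lball h r"
  have "z i \<in> {-\<lfloor>r\<rfloor>..\<lfloor>r\<rfloor>}" if "i < h" for i
    using abs_le_vnorm[OF that, of z] z by (simp add: lball_def) linarith
  then show "z \<in> {z. \<forall>i. (i \<in> {..<h} \<longrightarrow> z i \<in> {-\<lfloor>r\<rfloor>..\<lfloor>r\<rfloor>}) \<and> (i \<notin> {..<h} \<longrightarrow> z i = 0)}"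
    using z by (auto simp: lball_def int_vecs_def)
qed

lemma finite_lball: "finite (lball h r)"
  by (rule finite_subset[OF lball_subset_cube finite_set_of_finite_funs]) auto

lemma card_lball_pos:
  assumes "0 \<le> r"
  shows "0 < card (lball h r)"
proof -
  have "(\<lambda>_. 0) \<in> lball h r" using assms by (simp add: lball_def int_vecs_def vnorm_def L2_set_def)
  then show ?thesis using finite_lball by (auto simp: card_gt_0_iff)
qed

lemma lball_uminus: "z \<in> lball h r \<Longrightarrow> (\<lambda>i. - z i) \<in> lball h r"
  by (simp add: lball_def vnorm_uminus int_vecs_def)

text \<open>The map \<open>(w, e) \<mapsto> 2 w + e\<close> is injective since parities determine
  \<open>e\<close>; a cube vertex adds at most \<open>sqrt h\<close> to the norm.\<close>

lemma card_lball_double_ge: "2 ^ h * card (lball h r) \<le> card (lball h (2 * r + sqrt (real h)))"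
proof -
  let ?f = "\<lambda>(w, e) i. 2 * w i + e i :: int"
  have inj: "inj_on ?f (lball h r \<times> bits h)"
  proof (intro inj_onI)
    fix p q assume p: "p \<in> lball h r \<times> bits h" and q: "q \<in> lball h r \<times> bits h" and eq: "?f p = ?f q"
    obtain w e where [simp]: "p = (w, e)" by fastforce
    obtain w' e' where [simp]: "q = (w', e')" by fastforce
    have "w i = w' i \<and> e i = e' i" for i
    proof -
      have "e i \<in> {0, 1}" "e' i \<in> {0, 1}" using p q by (cases "i < h"; auto simp: bits_def int_vecs_def)+
      moreover have "2 * w i + e i = 2 * w' i + e' i" using fun_cong[OF eq, of i] by simp
      ultimately show ?thesis by auto presburger+
    qed
    then show "p = q" by auto
  qed
  have "?f ` (lball h r \<times> bits h) \<subseteq> lball h (2 * r + sqrt (real h))"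
  proof clarify
    fix w e assume we: "w \<in> lball h r" "e \<in> bits h"
    have "vnorm h (\<lambda>i. 2 * w i + e i) \<le> 2 * vnorm h w + vnorm h e"
      using vnorm_add_le[of h "\<lambda>i. 2 * w i" e] by (simp add: vnorm_double)
    then show "(\<lambda>i. 2 * w i + e i) \<in> lball h (2 * r + sqrt (real h))"
      using we vnorm_bits[of e h] by (auto simp: lball_def int_vecs_def bits_def)
  qed
  from card_mono[OF finite_lball this] have "card (lball h r \<times> bits h) \<le> card (lball h (2 * r + sqrt (real h)))"
    by (simp only: card_image[OF inj])
  then show ?thesis by (simp add: card_cartesian_product card_bits mult.commute)
qed

text \<open>Division with remainder by 2 writes each point as \<open>2 w + e\<close>, with at most
  \<open>2 ^ h\<close> choices of \<open>e\<close>.\<close>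

lemma card_lball_le_halve: "card (lball h r) \<le> 2 ^ h * card (lball h ((r + sqrt (real h)) / 2))"
proof -
  let ?f = "\<lambda>(w, e) i. 2 * w i + e i :: int"
  have "lball h r \<subseteq> ?f ` (lball h ((r + sqrt (real h)) / 2) \<times> bits h)"
  proof
    fix z assume z: "z \<in> lball h r"
    define w where "w = (\<lambda>i. z i div 2)"
    define e where "e = (\<lambda>i. z i mod 2)"
    have zwe: "z = (\<lambda>i. 2 * w i + e i)" by (simp add: w_def e_def)
    have e: "e \<in> bits h" using z by (auto simp: e_def bits_def int_vecs_def lball_def)
    have "(\<lambda>i. 2 * w i) = (\<lambda>i. z i + - e i)" by (simp add: zwe)
    then have "2 * vnorm h w \<le> vnorm h z + vnorm h e"
      using vnorm_add_le[of h z "\<lambda>i. - e i"] vnorm_double[of h w] by (simp add: vnorm_uminus)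
    then have "w \<in> lball h ((r + sqrt (real h)) / 2)"
      using z vnorm_bits[OF e] by (auto simp: lball_def int_vecs_def w_def)
    then show "z \<in> ?f ` (lball h ((r + sqrt (real h)) / 2) \<times> bits h)"
      using e zwe by (intro image_eqI[of _ _ "(w, e)"]) auto
  qed
  then have "card (lball h r) \<le> card (?f ` (lball h ((r + sqrt (real h)) / 2) \<times> bits h))"
    by (intro card_mono finite_imageI finite_cartesian_product finite_lball finite_bits)
  also have "\<dots> \<le> card (lball h ((r + sqrt (real h)) / 2) \<times> bits h)"
    by (intro card_image_le finite_cartesian_product finite_lball finite_bits)
  finally show ?thesis by (simp add: card_cartesian_product card_bits mult.commute)
qed

text \<open>Squared norms are integers, so only radii that are square roots of natural numbers
  matter. This turns the search for an extremal radius into a finite one.\<close>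

lemma lball_subset_lball_floor:
  assumes "0 \<le> s"
  shows "lball h s \<subseteq> lball h (sqrt (real (nat \<lfloor>s\<^sup>2\<rfloor>)))"
proof
  fix z assume z: "z \<in> lball h s"
  then have "(vnorm h z)\<^sup>2 \<le> s\<^sup>2" by (simp add: lball_def power_mono)
  then have "(\<Sum>i<h. (z i)\<^sup>2) \<le> \<lfloor>s\<^sup>2\<rfloor>" unfolding vnorm_sq by linarith
  then have "(vnorm h z)\<^sup>2 \<le> real (nat \<lfloor>s\<^sup>2\<rfloor>)" unfolding vnorm_sq by linarith
  then show "z \<in> lball h (sqrt (real (nat \<lfloor>s\<^sup>2\<rfloor>)))"
    using z by (simp add: lball_def real_le_rsqrt)
qed

text \<open>The number of lattice points in a ball of radius \<open>r\<close> may grow irregularly with \<open>r\<close>. Maximising it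
  against the weight \<open>(M + r\<^sup>2)\<^sup>-\<^sup>h\<close> selects a radius at which its growth is controlled in both
  directions, and comparison with the doubled and halved balls locates this radius.\<close>

lemma exists_extremal_radius:
  fixes M :: real
  assumes h: "0 < h" and M: "real h \<le> 10 * M"
  obtains r where "0 \<le> r"
    and "\<And>s. 0 \<le> s \<Longrightarrow> s\<^sup>2 \<le> 10 * M \<Longrightarrow>
          real (card (lball h s)) \<le> real (card (lball h r)) * ((M + s\<^sup>2) / (M + r\<^sup>2)) ^ h"
    and "sqrt (M / 2) \<le> r + sqrt (real h)"
    and "r\<^sup>2 - (r + sqrt (real h))\<^sup>2 / 2 \<le> M"
proof -
  have M0: "0 < M" using h M by linarith
  define \<Phi> where "\<Phi> = (\<lambda>m::nat. real (card (lball h (sqrt (real m)))) / (M + real m) ^ h)"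
  have "Max (\<Phi> ` {..nat \<lfloor>10 * M\<rfloor>}) \<in> \<Phi> ` {..nat \<lfloor>10 * M\<rfloor>}" by (intro Max_in) auto
  then obtain m where m0: "m \<in> {..nat \<lfloor>10 * M\<rfloor>}" "\<Phi> m = Max (\<Phi> ` {..nat \<lfloor>10 * M\<rfloor>})" by force
  have m: "m \<in> {..nat \<lfloor>10 * M\<rfloor>}" "\<And>k. k \<in> {..nat \<lfloor>10 * M\<rfloor>} \<Longrightarrow> \<Phi> k \<le> \<Phi> m"
    using m0 by simp_all
  define r where "r = sqrt (real m)"
  have r0: "0 \<le> r" and r2: "r\<^sup>2 = real m" by (auto simp: r_def)
  have rM: "r\<^sup>2 \<le> 10 * M" using m(1) M0 unfolding r2 by (simp add: le_nat_iff) linarith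
  define K where "K = real (card (lball h r))"
  have K0: "0 < K" unfolding K_def using card_lball_pos[OF r0] by simp
  have growth: "real (card (lball h s)) \<le> K * ((M + s\<^sup>2) / (M + r\<^sup>2)) ^ h"
    if s: "0 \<le> s" "s\<^sup>2 \<le> 10 * M" for s
  proof -
    define k where "k = nat \<lfloor>s\<^sup>2\<rfloor>"
    have k: "real k \<le> s\<^sup>2" by (simp add: k_def)
    have "k \<in> {..nat \<lfloor>10 * M\<rfloor>}" unfolding k_def using s(2) by (auto intro!: nat_mono floor_mono)
    then have "\<Phi> k \<le> \<Phi> m" by (rule m(2))
    then have "real (card (lball h (sqrt (real k)))) \<le> K * ((M + real k) / (M + r\<^sup>2)) ^ h"
      using M0 unfolding \<Phi>_def K_def r2 r_def[symmetric]
      by (simp add: power_divide field_simps add_pos_nonneg)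
    also have "\<dots> \<le> K * ((M + s\<^sup>2) / (M + r\<^sup>2)) ^ h"
      using k M0 K0 by (intro mult_left_mono power_mono divide_right_mono) auto
    finally show ?thesis
      using card_mono[OF finite_lball lball_subset_lball_floor[OF s(1), of h]] unfolding k_def by linarith
  qed
  have pos: "0 < M + r\<^sup>2" using M0 by (simp add: add_pos_nonneg)
  show ?thesis
  proof (rule that[of r])
    show "sqrt (M / 2) \<le> r + sqrt (real h)"
    proof -
      define s where "s = 2 * r + sqrt (real h)"
      have s0: "0 \<le> s" using r0 by (simp add: s_def)
      have "M / 2 \<le> (r + sqrt (real h))\<^sup>2"
      proof (cases "s\<^sup>2 \<le> 10 * M")
        case True
        have "2 ^ h * K \<le> K * ((M + s\<^sup>2) / (M + r\<^sup>2)) ^ h"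
          using growth[OF s0 True] card_lball_double_ge[of h r] unfolding s_def K_def
          by (metis (no_types, lifting) of_nat_le_iff of_nat_mult of_nat_numeral of_nat_power order_trans)
        then have "2 ^ h \<le> ((M + s\<^sup>2) / (M + r\<^sup>2)) ^ h" using K0 by simp
        then have "2 \<le> (M + s\<^sup>2) / (M + r\<^sup>2)"
          using power_mono_iff[of 2 "(M + s\<^sup>2) / (M + r\<^sup>2)" h] M0 h pos by simp
        then have "2 * (M + r\<^sup>2) \<le> M + s\<^sup>2" using pos by (simp add: field_simps)
        then show ?thesis unfolding s_def by (simp add: power2_sum power_mult_distrib)
      \<comment> \<open>If the doubled radius leaves the range of the maximisation,
        \<open>growth\<close> says nothing about it, but then \<open>r + sqrt h\<close> is large for
        that very reason.\<close>
      next
        case False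
        have "s\<^sup>2 \<le> (2 * (r + sqrt (real h)))\<^sup>2" using r0 unfolding s_def by (intro power_mono) auto
        then show ?thesis using False M0 unfolding power_mult_distrib by simp
      qed
      then show ?thesis using r0 by (simp add: real_le_lsqrt real_sqrt_le_iff)
    qed
    show "r\<^sup>2 - (r + sqrt (real h))\<^sup>2 / 2 \<le> M"
    proof -
      define s where "s = (r + sqrt (real h)) / 2"
      have s0: "0 \<le> s" using r0 by (simp add: s_def)
      \<comment> \<open>The halved radius always stays in the range of the maximisation, because
        both \<open>r\<^sup>2\<close> and \<open>h\<close> are at most
        \<open>10 * M\<close>.\<close>
      have "s\<^sup>2 \<le> (r\<^sup>2 + real h) / 2"
        using sum_squares_bound[of r "sqrt (real h)"] unfolding s_def by (simp add: power_divide power2_sum)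
      also have "\<dots> \<le> (10 * M + 10 * M) / 2" using rM M by (intro divide_right_mono add_mono) auto
      finally have sM: "s\<^sup>2 \<le> 10 * M" by simp
      have "K \<le> 2 ^ h * real (card (lball h s))"
        using card_lball_le_halve[of h r] unfolding s_def K_def
        by (metis (no_types, lifting) of_nat_le_iff of_nat_mult of_nat_numeral of_nat_power)
      also have "\<dots> \<le> 2 ^ h * (K * ((M + s\<^sup>2) / (M + r\<^sup>2)) ^ h)"
        using growth[OF s0 sM] by simp
      also have "\<dots> = K * (2 * ((M + s\<^sup>2) / (M + r\<^sup>2))) ^ h" by (simp only: power_mult_distrib mult_ac)
      finally have "1 ^ h \<le> (2 * ((M + s\<^sup>2) / (M + r\<^sup>2))) ^ h" using K0 by simp
      then have "1 \<le> 2 * ((M + s\<^sup>2) / (M + r\<^sup>2))"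
        using power_mono_iff[of 1 "2 * ((M + s\<^sup>2) / (M + r\<^sup>2))" h] M0 h pos by simp
      then have "M + r\<^sup>2 \<le> 2 * M + 2 * s\<^sup>2" using pos by (simp add: field_simps)
      then show ?thesis unfolding s_def by (simp add: power_divide)
    qed
  qed (use r0 growth K_def in auto)
qed

section \<open>Upper bound for the number of lattice points in a ball\<close>

lemma sum_power_nat_abs_le:
  fixes x :: real
  assumes "0 \<le> x" "x < 1"
  shows "(\<Sum>j = - int n..int n. x ^ nat \<bar>j\<bar>) \<le> 2 / (1 - x)"
proof -
  have "(\<Sum>j = - int n..int n. x ^ nat \<bar>j\<bar>) \<le> 2 * (\<Sum>k\<le>n. x ^ k)"
  proof (induction n)
    case (Suc n)
    have "{- int (Suc n)..int (Suc n)} = insert (- int (Suc n)) (insert (int (Suc n)) {- int n..int n})"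
      by auto
    then show ?case using Suc by (simp add: nat_add_distrib add.commute)
  qed simp
  also have "(\<Sum>k\<le>n. x ^ k) \<le> 1 / (1 - x)"
    using sum_gp0[of x n] assms by (simp add: divide_right_mono)
  finally show ?thesis by simp
qed

text \<open>Cauchy-Schwarz against the all-ones vector.\<close>

lemma sum_abs_le_vnorm: "(\<Sum>i<h. \<bar>real_of_int (z i)\<bar>) \<le> sqrt (real h) * vnorm h z"
  using L2_set_mult_ineq[of "\<lambda>i. real_of_int (z i)" "\<lambda>_. 1" "{..<h}"]
  by (simp add: vnorm_def L2_set_constant mult.commute)

text \<open>The ball lies in the \<open>\<ell>\<^sub>1\<close>-ball of radius \<open>r \<surd>h\<close>, whose points are counted by a product of
  geometric series.\<close>

lemma card_lball_le:
  assumes h: "0 < h" and r: "sqrt (real h) \<le> r"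
  shows "real (card (lball h r)) \<le> (4 * exp 1 * r / sqrt (real h)) ^ h"
proof -
  \<comment> \<open>With this rate the weight \<open>exp (- t * s)\<close>, where \<open>s\<close>
    is the sum of the absolute coordinates, is at least \<open>exp (- h)\<close> on the whole ball,
    as \<open>s \<le> sqrt h * r\<close>. The hypothesis on \<open>r\<close> gives
    \<open>t \<le> 1\<close>, which \<open>exp (- t) \<le> 1 - t / 2\<close> needs.\<close>
  define t where "t = sqrt (real h) / r"
  have r0: "0 < r" using h r by (smt (verit) of_nat_0_less_iff real_sqrt_gt_0_iff)
  have t: "0 < t" "t \<le> 1" using h r r0 by (auto simp: t_def)
  define x where "x = exp (- t)"
  have x: "0 < x" "x < 1" using t by (auto simp: x_def)
  have "exp (- t) \<le> 1 / (1 + t)"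
    using exp_ge_add_one_self[of t] t by (simp add: exp_minus field_simps)
  also have "\<dots> \<le> 1 - t / 2" using t mult_left_le[of t t] by (simp add: field_simps)
  finally have xt: "2 / (1 - x) \<le> 4 / t" using t x by (simp add: x_def field_simps)
  define N where "N = nat \<lfloor>r\<rfloor>"
  have N: "int N = \<lfloor>r\<rfloor>" using r0 by (simp add: N_def)
  define f where "f = (\<lambda>z::nat \<Rightarrow> int. \<Prod>i<h. x ^ nat \<bar>z i\<bar>)"
  have fz: "exp (- real h) \<le> f z" if z: "z \<in> lball h r" for z
  proof -
    have "(\<Sum>i<h. \<bar>real_of_int (z i)\<bar>) \<le> sqrt (real h) * r"
      using sum_abs_le_vnorm[of z h] z mult_left_mono[of "vnorm h z" r "sqrt (real h)"]
      by (simp add: lball_def)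
    then have "t * (\<Sum>i<h. \<bar>real_of_int (z i)\<bar>) \<le> t * (sqrt (real h) * r)"
      using t by (intro mult_left_mono) auto
    also have "\<dots> = real h" using r0 by (simp add: t_def)
    finally have "exp (- real h) \<le> exp (- t * (\<Sum>i<h. \<bar>real_of_int (z i)\<bar>))" by simp
    also have "\<dots> = f z" unfolding f_def x_def
      by (simp add: sum_distrib_left exp_sum mult.commute flip: exp_of_nat_mult sum_negf)
    finally show ?thesis .
  qed
  let ?C = "PiE {..<h} (\<lambda>_. {- int N..int N})"
  \<comment> \<open>Vectors of the ball are 0 from \<open>h\<close> on, whereas elements of
    \<open>PiE\<close> are \<open>undefined\<close> there; restriction translates, and
    \<open>f\<close> reads only the first \<open>h\<close> coordinates.\<close>
  have inj: "inj_on (\<lambda>z. restrict z {..<h}) (lball h r)"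
  proof (intro inj_onI ext)
    fix y z :: "nat \<Rightarrow> int" and i assume yz: "y \<in> lball h r" "z \<in> lball h r" "restrict y {..<h} = restrict z {..<h}"
    show "y i = z i"
      using yz(1,2) fun_cong[OF yz(3), of i] by (cases "i < h") (auto simp: lball_def int_vecs_def)
  qed
  have "real (card (lball h r)) * exp (- real h) \<le> (\<Sum>z\<in>lball h r. f z)"
    using fz sum_mono[of "lball h r" "\<lambda>_. exp (- real h)" f] by simp
  also have "\<dots> = (\<Sum>z\<in>(\<lambda>z. restrict z {..<h}) ` lball h r. f z)"
    by (simp add: sum.reindex[OF inj] f_def)
  also have "\<dots> \<le> (\<Sum>z\<in>?C. f z)"
  proof (rule sum_mono2)
    show "(\<lambda>z. restrict z {..<h}) ` lball h r \<subseteq> ?C"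
      using subsetD[OF lball_subset_cube[of h r]] unfolding N by (intro image_subsetI) auto
  qed (use x in \<open>auto simp: f_def finite_PiE intro!: prod_nonneg\<close>)
  also have "\<dots> = (\<Sum>j = - int N..int N. x ^ nat \<bar>j\<bar>) ^ h"
    unfolding f_def
    using prod_sum_PiE[of "{..<h}" "\<lambda>_. {- int N..int N}" "\<lambda>_ j. x ^ nat \<bar>j\<bar>"] by simp
  also have "\<dots> \<le> (4 / t) ^ h"
    using sum_power_nat_abs_le[of x N] x xt by (intro power_mono sum_nonneg) auto
  finally have "real (card (lball h r)) \<le> (4 / t) ^ h * exp (real h)"
    by (simp add: exp_minus field_simps)
  also have "\<dots> = (4 * exp 1 * r / sqrt (real h)) ^ h"
    using exp_of_nat_mult[of h "1::real"] by (simp add: t_def power_mult_distrib power_divide)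
  finally show ?thesis .
qed

text \<open>A lattice isodiametric inequality. By \<open>card_sumset_bits_ge\<close> for
  \<open>A\<close> and its negative, the differences plus cube vertices number at least
  \<open>2 ^ h * card A\<close>. They lie in a ball of radius \<open>d + sqrt h\<close>, and halving
  this ball gives back the factor \<open>2 ^ h\<close>.\<close>

lemma card_le_card_lball_of_diam_le:
  assumes fin: "finite A" and sub: "A \<subseteq> int_vecs h"
    and diam: "\<And>a b. a \<in> A \<Longrightarrow> b \<in> A \<Longrightarrow> vnorm h (\<lambda>i. a i - b i) \<le> d"
  shows "card A \<le> card (lball h (d / 2 + sqrt (real h)))"
proof -
  define B where "B = (\<lambda>a i. - a i) ` A"
  define D where "D = sumset_bits h A B"
  have cB: "card B = card A"
    unfolding B_def by (intro card_image inj_onI) (simp add: fun_eq_iff)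
  have "finite B" "B \<subseteq> int_vecs h" using fin sub by (auto simp: B_def int_vecs_def)
  then have "4 ^ h * (real (card A) * real (card B)) \<le> (real (card D))\<^sup>2"
    unfolding D_def using fin sub by (intro card_sumset_bits_ge)
  moreover have "4 ^ h * (real (card A) * real (card B)) = (2 ^ h * real (card A))\<^sup>2"
    unfolding cB by (simp add: power2_eq_square flip: power_mult_distrib)
  ultimately have "2 ^ h * real (card A) \<le> real (card D)" by (metis of_nat_0_le_iff power2_le_imp_le)
  also have "D \<subseteq> lball h (d + sqrt (real h))"
  proof
    fix z assume "z \<in> D"
    then obtain a b e where z: "a \<in> A" "b \<in> A" "e \<in> bits h" "z = (\<lambda>i. a i - b i + e i)"
      unfolding D_def sumset_bits_def B_def by auto
    have "vnorm h z \<le> vnorm h (\<lambda>i. a i - b i) + vnorm h e"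
      unfolding z(4) by (rule vnorm_add_le)
    then have "vnorm h z \<le> d + sqrt (real h)" using diam[OF z(1,2)] vnorm_bits[OF z(3)] by linarith
    moreover have "a \<in> int_vecs h" "b \<in> int_vecs h" using z sub by auto
    ultimately show "z \<in> lball h (d + sqrt (real h))"
      using z by (auto simp: lball_def int_vecs_def bits_def)
  qed
  then have "real (card D) \<le> real (card (lball h (d + sqrt (real h))))"
    by (simp add: card_mono finite_lball)
  also have "\<dots> \<le> real (2 ^ h * card (lball h ((d + sqrt (real h) + sqrt (real h)) / 2)))"
    using card_lball_le_halve[of h "d + sqrt (real h)"] by (simp only: of_nat_le_iff)
  also have "(d + sqrt (real h) + sqrt (real h)) / 2 = d / 2 + sqrt (real h)" by simp
  finally show ?thesis by simp
qed

section \<open>Inner products, halfspaces and slabs\<close>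

definition vinner :: "nat \<Rightarrow> (nat \<Rightarrow> int) \<Rightarrow> (nat \<Rightarrow> int) \<Rightarrow> real" where
  "vinner h x y = (\<Sum>i<h. real_of_int (x i) * real_of_int (y i))"

lemma vinner_uminus: "vinner h x (\<lambda>i. - y i) = - vinner h x y"
  by (simp add: vinner_def sum_negf)

lemma vinner_commute: "vinner h x y = vinner h y x"
  by (simp add: vinner_def mult.commute)

lemma vinner_add: "vinner h x (\<lambda>i. y i + z i) = vinner h x y + vinner h x z"
  by (simp add: vinner_def sum.distrib ring_distribs)

lemma vnorm_sq_eq_vinner: "(vnorm h x)\<^sup>2 = vinner h x x"
  unfolding vnorm_sq vinner_def by (simp add: power2_eq_square)

lemma vnorm_add_sq: "(vnorm h (\<lambda>i. x i + y i))\<^sup>2 = (vnorm h x)\<^sup>2 + 2 * vinner h x y + (vnorm h y)\<^sup>2"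
  unfolding vnorm_sq_eq_vinner vinner_def sum_distrib_left sum.distrib[symmetric]
  by (intro sum.cong) (auto simp: algebra_simps)

lemma vnorm_diff_sq: "(vnorm h (\<lambda>i. x i - y i))\<^sup>2 = (vnorm h x)\<^sup>2 - 2 * vinner h x y + (vnorm h y)\<^sup>2"
  using vnorm_add_sq[of h x "\<lambda>i. - y i"] by (simp add: vnorm_uminus vinner_uminus)

text \<open>The halfspace and its reflection in the origin cover \<open>S\<close>.\<close>

lemma card_halfspace_ge:
  assumes fin: "finite S" and sym: "\<And>z. z \<in> S \<Longrightarrow> (\<lambda>i. - z i) \<in> S"
  shows "card S \<le> 2 * card {y \<in> S. vinner h v y \<le> 0}"
proof -
  let ?H = "{y \<in> S. vinner h v y \<le> 0}"
  have "S \<subseteq> ?H \<union> (\<lambda>y i. - y i) ` ?H"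
  proof
    fix y assume y: "y \<in> S"
    show "y \<in> ?H \<union> (\<lambda>y i. - y i) ` ?H"
    proof (cases "vinner h v y \<le> 0")
      case False
      then have "(\<lambda>i. - y i) \<in> ?H" using sym[OF y] by (simp add: vinner_uminus)
      then have "(\<lambda>i. - (- y i)) \<in> (\<lambda>y i. - y i) ` ?H" by (rule imageI)
      then show ?thesis by simp
    qed (use y in simp)
  qed
  then have "card S \<le> card (?H \<union> (\<lambda>y i. - y i) ` ?H)" using fin by (intro card_mono) auto
  also have "\<dots> \<le> card ?H + card ((\<lambda>y i. - y i) ` ?H)" by (rule card_Un_le)
  also have "\<dots> \<le> card ?H + card ?H" using fin by (simp add: card_image_le)
  finally show ?thesis by simp
qed

text \<open>Half of the symmetric set makes an obtuse angle with the translation vector, and translating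
  that half increases squared norms by at most the squared length of the vector.\<close>

lemma card_disjoint_translates_le:
  assumes fin: "finite I" and S: "S \<subseteq> lball h r" and sym: "\<And>z. z \<in> S \<Longrightarrow> (\<lambda>i. - z i) \<in> S"
    and v: "\<And>j. j \<in> I \<Longrightarrow> v j \<in> lball h b"
    and disj: "\<And>j k y y'. j \<in> I \<Longrightarrow> k \<in> I \<Longrightarrow> y \<in> S \<Longrightarrow> y' \<in> S \<Longrightarrow>
      (\<lambda>i. y i + v j i) = (\<lambda>i. y' i + v k i) \<Longrightarrow> j = k"
  shows "card I * card S \<le> 2 * card (lball h (sqrt (r\<^sup>2 + b\<^sup>2)))"
proof -
  define H where "H = (\<lambda>j. {y \<in> S. vinner h (v j) y \<le> 0})"
  have finS: "finite S" using S finite_lball finite_subset by blast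
  let ?f = "\<lambda>(j, y) i. y i + v j i"
  have inj: "inj_on ?f (Sigma I H)"
  proof (rule inj_onI, clarify)
    fix j k y y' assume *: "j \<in> I" "k \<in> I" "y \<in> H j" "y' \<in> H k"
      "(\<lambda>i. y i + v j i) = (\<lambda>i. y' i + v k i)"
    then have jk: "j = k" by (intro disj[of j k y y']) (auto simp: H_def)
    moreover have "y = y'" using *(5) unfolding jk by (simp add: fun_eq_iff)
    ultimately show "j = k \<and> y = y'" by simp
  qed
  have sub: "?f ` Sigma I H \<subseteq> lball h (sqrt (r\<^sup>2 + b\<^sup>2))"
  proof clarify
    fix j y assume j: "j \<in> I" and y: "y \<in> H j"
    have yb: "y \<in> lball h r" and in0: "vinner h (v j) y \<le> 0" using y S by (auto simp: H_def)
    have "(vnorm h (\<lambda>i. y i + v j i))\<^sup>2 \<le> (vnorm h y)\<^sup>2 + (vnorm h (v j))\<^sup>2"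
      using in0 vnorm_add_sq[of h y "v j"] vinner_commute[of h y "v j"] by simp
    also have "\<dots> \<le> r\<^sup>2 + b\<^sup>2" using yb v[OF j] by (intro add_mono power_mono) (auto simp: lball_def)
    finally have "vnorm h (\<lambda>i. y i + v j i) \<le> sqrt (r\<^sup>2 + b\<^sup>2)" by (rule real_le_rsqrt)
    then show "(\<lambda>i. y i + v j i) \<in> lball h (sqrt (r\<^sup>2 + b\<^sup>2))"
      using yb v[OF j] by (auto simp: lball_def int_vecs_def)
  qed
  have "card I * card S = (\<Sum>j\<in>I. card S)" by simp
  also have "\<dots> \<le> (\<Sum>j\<in>I. 2 * card (H j))"
    unfolding H_def by (intro sum_mono card_halfspace_ge finS sym)
  also have "\<dots> = 2 * card (Sigma I H)"
    using fin finS by (simp add: sum_distrib_left[symmetric] H_def)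
  also have "card (Sigma I H) = card (?f ` Sigma I H)" using card_image[OF inj] by simp
  also have "\<dots> \<le> card (lball h (sqrt (r\<^sup>2 + b\<^sup>2)))" by (rule card_mono[OF finite_lball sub])
  finally show ?thesis by simp
qed

text \<open>Cauchy-Schwarz; it controls how much an inner product with \<open>x\<close> changes when
  a real vector is rounded to the lattice, \<open>e\<close> being the rounding error.\<close>

lemma abs_sum_mult_le_vnorm:
  assumes "\<And>i. i < h \<Longrightarrow> \<bar>e i\<bar> \<le> 1"
  shows "\<bar>\<Sum>i<h. real_of_int (x i) * e i\<bar> \<le> vnorm h x * sqrt (real h)"
proof -
  have "\<bar>\<Sum>i<h. real_of_int (x i) * e i\<bar> \<le> (\<Sum>i<h. \<bar>real_of_int (x i)\<bar> * \<bar>e i\<bar>)"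
    using sum_abs[of "\<lambda>i. real_of_int (x i) * e i" "{..<h}"] by (simp add: abs_mult)
  also have "\<dots> \<le> vnorm h x * L2_set e {..<h}" unfolding vnorm_def by (rule L2_set_mult_ineq)
  also have "L2_set e {..<h} \<le> L2_set (\<lambda>_. 1) {..<h}"
    unfolding L2_set_def using assms by (intro real_sqrt_le_mono sum_mono) (simp add: abs_square_le_1)
  finally show ?thesis by (simp add: L2_set_constant mult_left_mono)
qed

text \<open>The slab is translated by the multiples \<open>j * w\<close>, for
  \<open>\<bar>j\<bar> \<le> J\<close>, of the unit vector along \<open>x\<close>, rounded down to
  the lattice. Rounding shifts an inner product with \<open>x\<close> by at most
  \<open>sqrt h * vnorm h x\<close>, so the condition on \<open>w\<close> keeps the translates
  disjoint and \<open>card_disjoint_translates_le\<close> applies.\<close>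

lemma card_slab_le:
  assumes x: "0 < vnorm h x" and b: "0 \<le> b" and w: "2 * b + 2 * sqrt (real h) < w"
  shows "(2 * J + 1) * card {y \<in> lball h r. \<bar>vinner h x y\<bar> \<le> b * vnorm h x}
    \<le> 2 * card (lball h (sqrt (r\<^sup>2 + (real J * w + sqrt (real h))\<^sup>2)))"
proof -
  define S where "S = {y \<in> lball h r. \<bar>vinner h x y\<bar> \<le> b * vnorm h x}"
  define u where "u = (\<lambda>(j::int) i. real_of_int j * w * real_of_int (x i) / vnorm h x)"
  define v where "v = (\<lambda>j i. if i < h then \<lfloor>u j i\<rfloor> else 0)"
  define e where "e = (\<lambda>j i. real_of_int (v j i) - u j i)"
  have w0: "0 < w" using b w by (smt (verit) real_sqrt_ge_zero of_nat_0_le_iff)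
  have e: "\<bar>e j i\<bar> \<le> 1" if "i < h" for j i
    using that unfolding e_def v_def by simp linarith
  have in_v: "\<bar>vinner h x (v j) - real_of_int j * w * vnorm h x\<bar> \<le> vnorm h x * sqrt (real h)" for j
  proof -
    have "vinner h x (v j) = (\<Sum>i<h. real_of_int (x i) * u j i) + (\<Sum>i<h. real_of_int (x i) * e j i)"
      unfolding vinner_def sum.distrib[symmetric] by (intro sum.cong) (auto simp: e_def algebra_simps)
    also have "(\<Sum>i<h. real_of_int (x i) * u j i) = real_of_int j * w / vnorm h x * (vnorm h x)\<^sup>2"
      unfolding vnorm_sq_eq_vinner vinner_def sum_distrib_left
      by (intro sum.cong) (auto simp: u_def algebra_simps)
    also have "\<dots> = real_of_int j * w * vnorm h x" using x by (simp add: power2_eq_square)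
    finally show ?thesis using abs_sum_mult_le_vnorm[of h "e j" x] e by simp
  qed
  have v_ball: "v j \<in> lball h (real J * w + sqrt (real h))" if j: "j \<in> {- int J..int J}" for j
  proof -
    have "vnorm h (v j) = L2_set (\<lambda>i. u j i + e j i) {..<h}" by (simp add: vnorm_def e_def)
    also have "\<dots> \<le> L2_set (u j) {..<h} + L2_set (e j) {..<h}" by (rule L2_set_triangle_ineq)
    also have "L2_set (u j) {..<h} = \<bar>real_of_int j * w / vnorm h x\<bar> * vnorm h x"
    proof -
      have "(\<Sum>i<h. (u j i)\<^sup>2) = (real_of_int j * w / vnorm h x)\<^sup>2 * (vnorm h x)\<^sup>2"
        unfolding vnorm_sq of_int_sum sum_distrib_left
        by (intro sum.cong) (auto simp: u_def power_mult_distrib power_divide)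
      then show ?thesis by (simp add: L2_set_def real_sqrt_mult)
    qed
    also have "\<dots> = \<bar>real_of_int j\<bar> * w" using x w0 by (simp add: abs_mult)
    also have "\<dots> \<le> real J * w" using j w0 by (intro mult_right_mono) auto
    also have "L2_set (e j) {..<h} \<le> L2_set (\<lambda>_. 1) {..<h}"
      unfolding L2_set_def using e by (intro real_sqrt_le_mono sum_mono) (simp add: abs_square_le_1)
    finally show ?thesis by (simp add: lball_def int_vecs_def v_def L2_set_constant)
  qed
  have "card {- int J..int J} * card S \<le> 2 * card (lball h (sqrt (r\<^sup>2 + (real J * w + sqrt (real h))\<^sup>2)))"
  proof (rule card_disjoint_translates_le[where v = v])
    show "(\<lambda>i. - z i) \<in> S" if "z \<in> S" for z
      using that lball_uminus[of z h r] by (simp add: S_def vinner_uminus)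
    fix j k y y' assume y: "y \<in> S" "y' \<in> S" and eq: "(\<lambda>i. y i + v j i) = (\<lambda>i. y' i + v k i)"
    show "j = k"
    proof (rule ccontr)
      assume "j \<noteq> k"
      then have "1 \<le> \<bar>real_of_int j - real_of_int k\<bar>" by linarith
      then have "w * vnorm h x \<le> \<bar>real_of_int j - real_of_int k\<bar> * (w * vnorm h x)"
        using mult_right_mono[of 1 _ "w * vnorm h x"] w0 by simp
      also have "\<dots> = \<bar>real_of_int j * w * vnorm h x - real_of_int k * w * vnorm h x\<bar>"
        using w0 by (simp add: abs_mult left_diff_distrib[symmetric] mult.assoc)
      also have "\<dots> \<le> \<bar>vinner h x (v j) - vinner h x (v k)\<bar> + 2 * (vnorm h x * sqrt (real h))"
        using in_v[of j] in_v[of k] by linarith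
      also have "vinner h x (v j) - vinner h x (v k) = vinner h x y' - vinner h x y"
        using vinner_add[of h x y "v j"] vinner_add[of h x y' "v k"] unfolding eq by linarith
      also have "\<bar>\<dots>\<bar> \<le> 2 * (b * vnorm h x)" using y unfolding S_def by auto
      finally have "w * vnorm h x \<le> (2 * b + 2 * sqrt (real h)) * vnorm h x" by (simp add: algebra_simps)
      then show False using w x by simp
    qed
  qed (use v_ball in \<open>auto simp: S_def\<close>)
  moreover have "card {- int J..int J} = 2 * J + 1" by simp
  ultimately show ?thesis unfolding S_def by metis
qed

text \<open>Off the slab, half of the points have inner product above
  \<open>\<mu> * r * vnorm h x\<close> with \<open>x\<close>, by symmetry. For them the cosine
  formula puts the squared distance below the threshold.\<close>

lemma near_points_card_ge:
  assumes r: "0 < r" and \<mu>: "0 < \<mu>" "\<mu> \<le> 1 / 4" and x: "x \<in> lball h r" and \<delta>: "0 \<le> \<delta>"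
    and slab: "0 < vnorm h x \<Longrightarrow>
      real (card {y \<in> lball h r. \<bar>vinner h x y\<bar> \<le> \<mu> * r * vnorm h x}) \<le> \<delta> * real (card (lball h r))"
  shows "(1 - \<delta>) / 2 * real (card (lball h r))
    \<le> real (card {y \<in> lball h r. (vnorm h (\<lambda>i. x i - y i))\<^sup>2 < 2 * (1 - \<mu>) * r\<^sup>2})"
    (is "_ \<le> real (card ?T)")
proof (cases "vnorm h x = 0")
  \<comment> \<open>The zero vector has no slab; every point is then at squared distance at most
    \<open>r\<^sup>2\<close>, which is below the threshold because
    \<open>\<mu> < 1 / 2\<close>.\<close>
  case True
  have "lball h r \<subseteq> ?T"
  proof
    fix y assume y: "y \<in> lball h r"
    have "\<bar>vinner h x y\<bar> \<le> vnorm h x * vnorm h y"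
      unfolding vinner_def vnorm_def
      using sum_abs[of "\<lambda>i. real_of_int (x i) * real_of_int (y i)" "{..<h}"] L2_set_mult_ineq[of "\<lambda>i. real_of_int (x i)" "\<lambda>i. real_of_int (y i)" "{..<h}"]
      by (simp add: abs_mult)
    then have "(vnorm h (\<lambda>i. x i - y i))\<^sup>2 = (vnorm h y)\<^sup>2" using True by (simp add: vnorm_diff_sq)
    also have "\<dots> \<le> r\<^sup>2" using y by (intro power_mono) (auto simp: lball_def)
    also have "\<dots> < 2 * (1 - \<mu>) * r\<^sup>2" using \<mu> r by simp
    finally show "y \<in> ?T" using y by simp
  qed
  then have "card (lball h r) \<le> card ?T" by (intro card_mono) (auto simp: finite_lball)
  moreover have "(1 - \<delta>) / 2 * real (card (lball h r)) \<le> 1 * real (card (lball h r))"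
    using \<delta> by (intro mult_right_mono) auto
  ultimately show ?thesis by simp
next
  case False
  define X where "X = vnorm h x"
  have X: "0 < X" "X \<le> r" using False x by (auto simp: X_def lball_def less_le)
  define S where "S = {y \<in> lball h r. \<bar>vinner h x y\<bar> \<le> \<mu> * r * X}"
  define Q where "Q = lball h r - S"
  have Qsym: "(\<lambda>i. - z i) \<in> Q" if "z \<in> Q" for z
    using that lball_uminus[of z h r] by (auto simp: Q_def S_def vinner_uminus)
  have "card Q \<le> 2 * card {y \<in> Q. vinner h (\<lambda>i. - x i) y \<le> 0}"
    using Qsym finite_lball by (intro card_halfspace_ge) (auto simp: Q_def)
  also have "{y \<in> Q. vinner h (\<lambda>i. - x i) y \<le> 0} \<subseteq> ?T"
  proof
    fix y assume "y \<in> {y \<in> Q. vinner h (\<lambda>i. - x i) y \<le> 0}"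
    then have y: "y \<in> lball h r" "\<mu> * r * X < vinner h x y"
      using vinner_uminus[of h y x] vinner_commute[of h y] by (auto simp: Q_def S_def)
    have "(vnorm h y)\<^sup>2 \<le> r\<^sup>2" using y by (intro power_mono) (auto simp: lball_def)
    then have "(vnorm h (\<lambda>i. x i - y i))\<^sup>2 < X\<^sup>2 - 2 * (\<mu> * r * X) + r\<^sup>2"
      using y(2) by (simp add: vnorm_diff_sq X_def)
    also have "\<dots> \<le> 2 * (1 - \<mu>) * r\<^sup>2"
    proof -
      have "2 * (\<mu> * r) \<le> r" using \<mu> r by simp
      \<comment> \<open>This product is exactly the difference of the two sides.\<close>
      then have "0 \<le> (r - X) * (r + X - 2 * (\<mu> * r))" using X by (intro mult_nonneg_nonneg) linarith+
      then show ?thesis by (simp add: power2_eq_square algebra_simps)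
    qed
    finally show "y \<in> ?T" using y by simp
  qed
  then have "card {y \<in> Q. vinner h (\<lambda>i. - x i) y \<le> 0} \<le> card ?T"
    by (intro card_mono) (auto simp: finite_lball)
  finally have "real (card Q) \<le> 2 * real (card ?T)" by linarith
  moreover have "real (card Q) = real (card (lball h r)) - real (card S)"
    unfolding Q_def S_def by (subst card_Diff_subset) (auto simp: finite_lball of_nat_diff card_mono)
  moreover have "real (card S) \<le> \<delta> * real (card (lball h r))"
    using slab X unfolding S_def X_def by simp
  ultimately show ?thesis by (simp add: algebra_simps)
qed

section \<open>Choice of the radius\<close>

lemma exists_good_radius:
  fixes \<epsilon> :: real
  assumes \<epsilon>: "0 < \<epsilon>" "\<epsilon> < 1" and h: "16 \<le> h"
  defines "\<mu> \<equiv> \<epsilon> / sqrt (real h)"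
  obtains r where "0 < r"
    and "real (card (lball h r)) \<le> (2460 * sqrt (real h) / \<epsilon>) ^ h"
    and "\<And>A. A \<subseteq> lball h r \<Longrightarrow>
        (\<And>a b. a \<in> A \<Longrightarrow> b \<in> A \<Longrightarrow> (vnorm h (\<lambda>i. a i - b i))\<^sup>2 \<le> 4 * (1 - \<mu>) * r\<^sup>2) \<Longrightarrow>
        real (card A) \<le> real (card (lball h r)) * exp (- (\<epsilon> * sqrt (real h) / 4))"
    and "\<And>x. \<epsilon> < 1 / 8 \<Longrightarrow> x \<in> lball h r \<Longrightarrow> (1 - 6 * \<epsilon>) / 2 * real (card (lball h r))
        \<le> real (card {y \<in> lball h r. (vnorm h (\<lambda>i. x i - y i))\<^sup>2 < 2 * (1 - \<mu>) * r\<^sup>2})"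
proof -
  define a where "a = sqrt (real h)"
  have a2: "a\<^sup>2 = real h" by (simp add: a_def)
  have "sqrt (4\<^sup>2) \<le> a" using h unfolding a_def by (intro real_sqrt_le_mono) simp
  then have a4: "4 \<le> a" by simp
  have \<mu>a: "\<mu> * a = \<epsilon>" using a4 by (simp add: \<mu>_def a_def[symmetric])
  have \<mu>0: "0 < \<mu>" using \<epsilon> a4 by (simp add: \<mu>_def a_def[symmetric])
  have \<mu>4: "\<mu> \<le> 1 / 4" using \<epsilon> a4 by (simp add: \<mu>_def a_def[symmetric] field_simps)
  \<comment> \<open>The scale at which \<open>\<mu> * c = sqrt h\<close>: for
    \<open>r \<ge> 100 * c\<close>, all lattice errors of size \<open>sqrt h\<close> are at most one
    percent of the slab half-width \<open>\<mu> * r\<close>.\<close>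
  define c where "c = real h / \<epsilon>"
  have c_eq: "c * \<mu> = a" using \<epsilon> a4 a2[symmetric] by (simp add: c_def \<mu>_def a_def[symmetric] power2_eq_square)
  have c0: "0 < c" using \<epsilon> h by (simp add: c_def)
  have ac: "4 * a \<le> c" using mult_left_mono[OF \<mu>4 less_imp_le[OF c0]] c_eq by linarith
  \<comment> \<open>Then \<open>sqrt (M / 2) = 101 * c\<close>, and subtracting
    \<open>a \<le> c / 4\<close> still leaves \<open>r \<ge> 100 * c\<close>.\<close>
  define M where "M = 2 * (101 * c)\<^sup>2"
  have M_eq: "M = 20402 * c\<^sup>2" by (simp add: M_def power_mult_distrib)
  have M0: "0 < M" using c0 by (simp add: M_def)
  have hM: "real h \<le> 10 * M"
  proof -
    have "a\<^sup>2 \<le> c\<^sup>2" using ac a4 by (intro power_mono) auto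
    then show ?thesis unfolding a2 M_eq using zero_le_power2[of c] by linarith
  qed
  have "0 < h" using h by simp
  from exists_extremal_radius[OF this hM] obtain r where r0: "0 \<le> r"
    and growth: "\<And>s. 0 \<le> s \<Longrightarrow> s\<^sup>2 \<le> 10 * M \<Longrightarrow>
          real (card (lball h s)) \<le> real (card (lball h r)) * ((M + s\<^sup>2) / (M + r\<^sup>2)) ^ h"
    and low: "sqrt (M / 2) \<le> r + a"
    and up: "r\<^sup>2 - (r + a)\<^sup>2 / 2 \<le> M"
    unfolding a_def by blast
  have "sqrt (M / 2) = 101 * c" unfolding M_def using c0 by (intro real_sqrt_unique) auto
  then have rc: "100 * c \<le> r" using low ac a4 by linarith
  have r: "0 < r" using rc c0 by linarith
  have ar: "100 * a \<le> \<mu> * r"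
    using mult_right_mono[OF rc less_imp_le[OF \<mu>0]] c_eq by (metis mult.assoc mult.commute)
  have ar4: "400 * a \<le> r"
    using ar mult_right_mono[OF \<mu>4, of r] r0 by linarith
  \<comment> \<open>This bound and the next make \<open>r\<^sup>2\<close> and \<open>M\<close>
    comparable, roughly within a factor of 2, so that the growth bound reacts to changes of the
    radius almost as volume does.\<close>
  have r2low: "49 / 100 * M \<le> r\<^sup>2"
  proof -
    have "10000 * c\<^sup>2 \<le> r\<^sup>2" using power_mono[OF rc, of 2] c0 by (simp add: power_mult_distrib)
    then show ?thesis unfolding M_eq using zero_le_power2[of c] by linarith
  qed
  have r2up: "r\<^sup>2 \<le> 101 / 50 * M"
  proof -
    have "(r + a)\<^sup>2 \<le> (401 / 400 * r)\<^sup>2" using ar4 r0 a4 by (intro power_mono) auto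
    then have "160000 * (r + a)\<^sup>2 \<le> 160801 * r\<^sup>2" by (simp add: power_mult_distrib power_divide)
    then show ?thesis using up M0 zero_le_power2[of r] by linarith
  qed
  have rup: "r \<le> 205 * c"
  proof (rule power2_le_imp_le)
    have "r\<^sup>2 \<le> 42025 * c\<^sup>2" using r2up zero_le_power2[of c] unfolding M_eq by linarith
    then show "r\<^sup>2 \<le> (205 * c)\<^sup>2" by (simp add: power_mult_distrib)
  qed (use c0 in simp)
  define K where "K = real (card (lball h r))"
  have K0: "0 \<le> K" by (simp add: K_def)
  show ?thesis
  proof (rule that[of r])
    show "real (card (lball h r)) \<le> (2460 * sqrt (real h) / \<epsilon>) ^ h"
    proof -
      have "real (card (lball h r)) \<le> (4 * exp 1 * r / a) ^ h"
        unfolding a_def by (rule card_lball_le) (use h ar4 a4 a_def in auto)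
      also have "\<dots> \<le> (2460 * a / \<epsilon>) ^ h"
      proof (rule power_mono)
        have "4 * exp 1 * r / a \<le> 4 * 3 * (205 * c) / a"
          using rup r0 a4 exp_le by (intro divide_right_mono mult_mono) auto
        also have "\<dots> = 2460 * a / \<epsilon>"
          using a2[symmetric] a4 by (simp add: c_def power2_eq_square)
        finally show "4 * exp 1 * r / a \<le> 2460 * a / \<epsilon>" .
      qed (use r0 a4 in auto)
      finally show ?thesis by (simp add: a_def)
    qed
  next
    fix A assume A: "A \<subseteq> lball h r"
      and diam: "\<And>a b. a \<in> A \<Longrightarrow> b \<in> A \<Longrightarrow> (vnorm h (\<lambda>i. a i - b i))\<^sup>2 \<le> 4 * (1 - \<mu>) * r\<^sup>2"
    define d where "d = 2 * (sqrt (1 - \<mu>) * r)"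
    have d2: "d\<^sup>2 = 4 * (1 - \<mu>) * r\<^sup>2" using \<mu>4 by (simp add: d_def power_mult_distrib)
    have d0: "0 \<le> d" using r0 \<mu>4 by (simp add: d_def)
    define s where "s = d / 2 + a"
    have "vnorm h (\<lambda>i. x i - y i) \<le> d" if "x \<in> A" "y \<in> A" for x y
      using diam[OF that] d0 unfolding d2[symmetric] by (rule power2_le_imp_le)
    then have cA: "card A \<le> card (lball h s)" unfolding s_def a_def
      using A finite_subset[OF A finite_lball] by (intro card_le_card_lball_of_diam_le) (auto simp: lball_def)
    \<comment> \<open>The lattice error \<open>a\<close> costs little more than
      \<open>2 * r * a \<le> \<mu> * r\<^sup>2 / 50\<close>, which is within 3 percent of the gain
      \<open>\<mu> * r\<^sup>2\<close>.\<close>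
    have s2: "s\<^sup>2 \<le> (1 - 97 / 100 * \<mu>) * r\<^sup>2"
    proof -
      have "d / 2 \<le> r" using \<mu>0 r0 mult_right_mono[of "sqrt (1 - \<mu>)" 1 r] by (simp add: d_def)
      then have "d / 2 * a \<le> r * a" using a4 by (intro mult_right_mono) auto
      then have "s\<^sup>2 \<le> d\<^sup>2 / 4 + 2 * (r * a) + a\<^sup>2" unfolding s_def by (simp add: power2_sum power_divide)
      also have "a\<^sup>2 \<le> r * a / 400" using ar4 a4 by (simp add: power2_eq_square)
      finally have "s\<^sup>2 \<le> d\<^sup>2 / 4 + 2 * (r * a) + r * a / 400" by simp
      moreover have "r * a \<le> r * (\<mu> * r / 100)" using ar r0 by (intro mult_left_mono) auto
      moreover have "r * (\<mu> * r / 100) = \<mu> * r\<^sup>2 / 100" by (simp add: power2_eq_square)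
      moreover have "d\<^sup>2 / 4 = r\<^sup>2 - \<mu> * r\<^sup>2" unfolding d2 by (simp add: field_simps)
      moreover have "(1 - 97 / 100 * \<mu>) * r\<^sup>2 = r\<^sup>2 - 97 / 100 * (\<mu> * r\<^sup>2)" by (simp add: algebra_simps)
      moreover have "0 \<le> \<mu> * r\<^sup>2" using \<mu>0 by simp
      ultimately show ?thesis by linarith
    qed
    have s0: "0 \<le> s" using d0 a4 by (simp add: s_def)
    have "(1 - 97 / 100 * \<mu>) * r\<^sup>2 \<le> 1 * r\<^sup>2" using \<mu>0 by (intro mult_right_mono) auto
    then have sM: "s\<^sup>2 \<le> 10 * M" using s2 r2up M0 by linarith
    have "(M + s\<^sup>2) / (M + r\<^sup>2) \<le> 1 - \<mu> / 4"
    proof -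
      \<comment> \<open>Here \<open>72 / 25 = 4 * (97 / 100 - 1 / 4)\<close>, just what is needed
        for the decrease to survive adding \<open>M\<close> to numerator and denominator.\<close>
      have "\<mu> * M \<le> \<mu> * (72 / 25 * r\<^sup>2)" using r2low M0 \<mu>0 by (intro mult_left_mono) auto
      moreover have "(1 - \<mu> / 4) * (M + r\<^sup>2) = M + r\<^sup>2 - \<mu> * M / 4 - \<mu> * r\<^sup>2 / 4"
        "(1 - 97 / 100 * \<mu>) * r\<^sup>2 = r\<^sup>2 - 97 / 100 * (\<mu> * r\<^sup>2)"
        "\<mu> * (72 / 25 * r\<^sup>2) = 72 / 25 * (\<mu> * r\<^sup>2)"
        by (simp_all add: algebra_simps)
      ultimately have "M + s\<^sup>2 \<le> (1 - \<mu> / 4) * (M + r\<^sup>2)" using s2 by linarith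
      then show ?thesis using M0 by (simp add: divide_le_eq add_pos_nonneg)
    qed
    also have "\<dots> \<le> exp (- (\<mu> / 4))" using exp_ge_add_one_self[of "- (\<mu> / 4)"] by simp
    finally have "((M + s\<^sup>2) / (M + r\<^sup>2)) ^ h \<le> exp (- (\<mu> / 4)) ^ h"
      using M0 by (intro power_mono) auto
    also have "\<dots> = exp (- (\<epsilon> * a / 4))"
      unfolding exp_of_nat_mult[symmetric] a2[symmetric] \<mu>a[symmetric] by (simp add: power2_eq_square mult_ac)
    finally have "K * ((M + s\<^sup>2) / (M + r\<^sup>2)) ^ h \<le> K * exp (- (\<epsilon> * a / 4))"
      using K0 by (intro mult_left_mono)
    then show "real (card A) \<le> real (card (lball h r)) * exp (- (\<epsilon> * sqrt (real h) / 4))"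
      using cA growth[OF s0 sM] unfolding K_def a_def by linarith
  next
    fix x assume e8: "\<epsilon> < 1 / 8" and x: "x \<in> lball h r"
    have "real (card {y \<in> lball h r. \<bar>vinner h x y\<bar> \<le> \<mu> * r * vnorm h x}) \<le> 6 * \<epsilon> * K"
      if x0: "0 < vnorm h x"
    proof -
      define S where "S = {y \<in> lball h r. \<bar>vinner h x y\<bar> \<le> \<mu> * r * vnorm h x}"
      \<comment> \<open>Spacing just above the slab width \<open>2 * \<mu> * r\<close> plus the
        rounding loss \<open>2 * a \<le> \<mu> * r / 50\<close>.\<close>
      define w where "w = 203 / 100 * (\<mu> * r)"
      \<comment> \<open>As many translates as keep the shift \<open>b\<close> below
        \<open>163 / 200 * (r / a)\<close>. The ball then grows by a factor of at most
        \<open>exp (2 / 3) \<le> 2\<close>.\<close>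
      define J where "J = nat \<lfloor>2 / 5 / \<epsilon>\<rfloor>"
      have J1: "real J \<le> 2 / 5 / \<epsilon>" using \<epsilon> by (simp add: J_def)
      have J2: "2 / 5 / \<epsilon> - 1 \<le> real J" using \<epsilon> unfolding J_def by linarith
      define b where "b = real J * w + a"
      have \<mu>r: "0 < \<mu> * r" using \<mu>0 r by simp
      have "(2 * J + 1) * card S \<le> 2 * card (lball h (sqrt (r\<^sup>2 + b\<^sup>2)))"
        unfolding S_def b_def a_def
        by (rule card_slab_le) (use x0 \<mu>r ar in \<open>auto simp: w_def a_def[symmetric]\<close>)
      then have "real ((2 * J + 1) * card S) \<le> real (2 * card (lball h (sqrt (r\<^sup>2 + b\<^sup>2))))"
        by (simp only: of_nat_le_iff)
      then have SJ: "(2 * real J + 1) * real (card S) \<le> 2 * real (card (lball h (sqrt (r\<^sup>2 + b\<^sup>2))))"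
        by (simp add: algebra_simps)
      have b0: "0 \<le> b" using \<mu>r a4 by (simp add: b_def w_def)
      have "b \<le> 2 / 5 / \<epsilon> * (203 / 100 * (\<mu> * r)) + \<mu> * r / 100"
        unfolding b_def w_def using J1 \<mu>r ar by (intro add_mono mult_right_mono) auto
      also have "\<dots> = (203 / 250 + \<epsilon> / 100) * (r / a)"
        using \<epsilon> a4 by (simp add: \<mu>_def a_def[symmetric] field_simps)
      also have "\<dots> \<le> 163 / 200 * (r / a)" using e8 r0 a4 by (intro mult_right_mono) auto
      finally have "b\<^sup>2 \<le> (163 / 200 * (r / a))\<^sup>2" using b0 by (intro power_mono)
      also have "\<dots> \<le> 2 / 3 * r\<^sup>2 / real h"
        unfolding power_mult_distrib power_divide a2 using h by (simp add: divide_right_mono field_simps)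
      finally have b2: "b\<^sup>2 \<le> 2 / 3 * r\<^sup>2 / real h" .
      also have "\<dots> \<le> r\<^sup>2 / 1" using h by (intro frac_le) auto
      finally have sM: "(sqrt (r\<^sup>2 + b\<^sup>2))\<^sup>2 \<le> 10 * M" using r2up M0 by simp
      have "(M + (sqrt (r\<^sup>2 + b\<^sup>2))\<^sup>2) / (M + r\<^sup>2) \<le> 1 + 2 / 3 / real h"
      proof -
        have "2 / 3 * r\<^sup>2 / real h \<le> 2 / 3 * (M + r\<^sup>2) / real h" using M0 by (intro divide_right_mono) auto
        then have "M + (r\<^sup>2 + b\<^sup>2) \<le> (1 + 2 / 3 / real h) * (M + r\<^sup>2)" using b2 by (simp add: algebra_simps)
        then show ?thesis using M0 by (simp add: divide_le_eq add_pos_nonneg)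
      qed
      also have "\<dots> \<le> exp (2 / 3 / real h)" by (rule exp_ge_add_one_self)
      finally have "((M + (sqrt (r\<^sup>2 + b\<^sup>2))\<^sup>2) / (M + r\<^sup>2)) ^ h \<le> exp (2 / 3 / real h) ^ h"
        using M0 by (intro power_mono) auto
      also have "\<dots> = exp (2 / 3)" unfolding exp_of_nat_mult[symmetric] using h by simp
      also have "\<dots> \<le> exp (ln 2)" using ln2_ge_two_thirds by (simp only: exp_le_cancel_iff)
      finally have "K * ((M + (sqrt (r\<^sup>2 + b\<^sup>2))\<^sup>2) / (M + r\<^sup>2)) ^ h \<le> K * 2"
        using K0 by (intro mult_left_mono) auto
      then have "(2 * real J + 1) * real (card S) \<le> 4 * K"
        using SJ growth[OF _ sM] unfolding K_def by simp
      \<comment> \<open>From \<open>2 * J + 1 \<ge> 4 / 5 / \<epsilon> - 1\<close> and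
        \<open>\<epsilon> < 1 / 8\<close>; the constant 6 then comes from
        \<open>4 * 40 / 27 < 6\<close>.\<close>
      moreover have "27 / 40 / \<epsilon> \<le> 2 * real J + 1" using J2 e8 \<epsilon> by (simp add: field_simps)
      then have "27 / 40 / \<epsilon> * real (card S) \<le> (2 * real J + 1) * real (card S)" by (intro mult_right_mono) auto
      ultimately have "27 / 40 / \<epsilon> * real (card S) \<le> 4 * K" by linarith
      then have "27 / 40 * real (card S) \<le> 4 * (\<epsilon> * K)" using \<epsilon> by (simp add: field_simps)
      moreover have "0 \<le> \<epsilon> * K" using \<epsilon> K0 by simp
      ultimately have "real (card S) \<le> 6 * (\<epsilon> * K)" by linarith
      then show ?thesis unfolding S_def by simp
    qed
    then show "(1 - 6 * \<epsilon>) / 2 * real (card (lball h r))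
        \<le> real (card {y \<in> lball h r. (vnorm h (\<lambda>i. x i - y i))\<^sup>2 < 2 * (1 - \<mu>) * r\<^sup>2})"
      unfolding K_def using r \<mu>0 \<mu>4 x \<epsilon> by (intro near_points_card_ge) auto
  qed (rule r)
qed

section \<open>Graphs from point sets\<close>

text \<open>Each full block of \<open>K\<close> consecutive numbers meets the residue class once;
  the incomplete last block accounts for the \<open>+ 1\<close>.\<close>

lemma card_mod_eq_bounds:
  assumes K: "0 < K" and k: "k < K"
  shows "N div K \<le> card {v. v < N \<and> v mod K = k}" "card {v. v < N \<and> v mod K = k} \<le> N div K + 1"
proof -
  have fin: "finite {v. v < N \<and> v mod K = k}" by simp
  have "(\<lambda>i. k + K * i) ` {..<N div K} \<subseteq> {v. v < N \<and> v mod K = k}"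
  proof clarify
    fix i assume "i < N div K"
    then have "K * Suc i \<le> K * (N div K)" by (intro mult_le_mono2) simp
    also have "\<dots> \<le> N" by (rule times_div_less_eq_dividend)
    finally have "K + K * i \<le> N" by simp
    then show "k + K * i < N \<and> (k + K * i) mod K = k" using k by simp
  qed
  from card_mono[OF fin this] show "N div K \<le> card {v. v < N \<and> v mod K = k}"
    using K by (subst (asm) card_image) (auto intro!: inj_onI)
  have "inj_on (\<lambda>v. v div K) {v. v < N \<and> v mod K = k}"
    by (intro inj_onI) (metis (mono_tags, lifting) div_mult_mod_eq mem_Collect_eq)
  moreover have "(\<lambda>v. v div K) ` {v. v < N \<and> v mod K = k} \<subseteq> {..N div K}"
    by (auto intro: div_le_mono)
  ultimately show "card {v. v < N \<and> v mod K = k} \<le> N div K + 1"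
    using card_inj_on_le[of "\<lambda>v. v div K" _ "{..N div K}"] by fastforce
qed

text \<open>Running cyclically through an enumeration of \<open>P\<close> hits every point
  \<open>N div card P\<close> times or once more.\<close>

lemma exists_balanced_map:
  assumes "finite P" "P \<noteq> {}"
  obtains \<psi> :: "nat \<Rightarrow> 'a" where "\<And>v. \<psi> v \<in> P"
    and "\<And>A. A \<subseteq> P \<Longrightarrow> (N div card P) * card A \<le> card {v. v < N \<and> \<psi> v \<in> A}"
    and "\<And>A. A \<subseteq> P \<Longrightarrow> card {v. v < N \<and> \<psi> v \<in> A} \<le> (N div card P + 1) * card A"
proof -
  define K where "K = card P"
  have K: "0 < K" using assms by (simp add: K_def card_gt_0_iff)
  obtain p where p: "bij_betw p {0..<K} P" using ex_bij_betw_nat_finite[OF assms(1)] K_def by auto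
  define \<psi> where "\<psi> = (\<lambda>v. p (v mod K))"
  have mem: "\<psi> v \<in> P" for v using bij_betwE[OF p] K by (simp add: \<psi>_def)
  have fib: "\<exists>k<K. {v. v < N \<and> \<psi> v = a} = {v. v < N \<and> v mod K = k}" if a: "a \<in> P" for a
  proof -
    obtain k where k: "k < K" "a = p k" using p a unfolding bij_betw_def by auto
    have "\<psi> v = a \<longleftrightarrow> v mod K = k" for v
      unfolding \<psi>_def k(2) using inj_on_eq_iff[OF bij_betw_imp_inj_on[OF p]] k(1) K by simp
    then show ?thesis using k(1) by auto
  qed
  have cnt: "card {v. v < N \<and> \<psi> v \<in> A} = (\<Sum>a\<in>A. card {v. v < N \<and> \<psi> v = a})" if "A \<subseteq> P" for A
  proof -
    have "{v. v < N \<and> \<psi> v \<in> A} = (\<Union>a\<in>A. {v. v < N \<and> \<psi> v = a})" by auto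
    also have "card \<dots> = (\<Sum>a\<in>A. card {v. v < N \<and> \<psi> v = a})"
      using finite_subset[OF that assms(1)] by (intro card_UN_disjoint) auto
    finally show ?thesis .
  qed
  show ?thesis
  proof (rule that[of \<psi>])
    fix A assume A: "A \<subseteq> P"
    have "N div K \<le> card {v. v < N \<and> \<psi> v = a} \<and> card {v. v < N \<and> \<psi> v = a} \<le> N div K + 1"
      if "a \<in> A" for a
      using fib[of a] that A card_mod_eq_bounds[OF K, of _ N] by force
    then show "(N div card P) * card A \<le> card {v. v < N \<and> \<psi> v \<in> A}"
      "card {v. v < N \<and> \<psi> v \<in> A} \<le> (N div card P + 1) * card A"
      unfolding cnt[OF A] K_def[symmetric]
      using sum_bounded_below[of A "N div K"] sum_bounded_above[of A _ "N div K + 1"]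
      by (auto simp: mult.commute)
  qed (rule mem)
qed

section \<open>Distance inequalities and the Bollobas-Erdos graph\<close>

lemma vnorm_diff_triangle_sq:
  assumes "x \<in> lball h r" "y \<in> lball h r" "z \<in> lball h r"
  shows "(vnorm h (\<lambda>i. x i - y i))\<^sup>2 + (vnorm h (\<lambda>i. y i - z i))\<^sup>2 + (vnorm h (\<lambda>i. x i - z i))\<^sup>2 \<le> 9 * r\<^sup>2"
proof -
  have sq: "(vnorm h u)\<^sup>2 \<le> r\<^sup>2" if "u \<in> lball h r" for u
    using that by (intro power_mono) (auto simp: lball_def)
  have "0 \<le> (vnorm h (\<lambda>i. x i + (y i + z i)))\<^sup>2" by simp
  also have "\<dots> = (vnorm h x)\<^sup>2 + 2 * (vinner h x y + vinner h x z) +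
      ((vnorm h y)\<^sup>2 + 2 * vinner h y z + (vnorm h z)\<^sup>2)"
    by (simp only: vnorm_add_sq vinner_add)
  finally show ?thesis using sq[OF assms(1)] sq[OF assms(2)] sq[OF assms(3)] by (simp add: vnorm_diff_sq)
qed

text \<open>The squared norm of \<open>(a + b) - (c + d)\<close> is nonnegative. With
  \<open>a\<close>, \<open>b\<close> on one side and \<open>c\<close>, \<open>d\<close> on the
  other, this rules out a \<open>K\<^sub>4\<close>.\<close>

lemma vnorm_diff_quadrilateral_sq:
  "(vnorm h (\<lambda>i. a i - b i))\<^sup>2 + (vnorm h (\<lambda>i. c i - d i))\<^sup>2 \<le>
   (vnorm h (\<lambda>i. a i - c i))\<^sup>2 + (vnorm h (\<lambda>i. a i - d i))\<^sup>2 +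
   (vnorm h (\<lambda>i. b i - c i))\<^sup>2 + (vnorm h (\<lambda>i. b i - d i))\<^sup>2"
proof -
  have "0 \<le> (vnorm h (\<lambda>i. (a i + b i) - (c i + d i)))\<^sup>2" by simp
  also have "\<dots> = (vnorm h (\<lambda>i. a i + b i))\<^sup>2 - 2 * vinner h (\<lambda>i. a i + b i) (\<lambda>i. c i + d i)
      + (vnorm h (\<lambda>i. c i + d i))\<^sup>2"
    by (simp only: vnorm_diff_sq)
  also have "vinner h (\<lambda>i. a i + b i) (\<lambda>i. c i + d i) = vinner h a c + vinner h b c + (vinner h a d + vinner h b d)"
    by (simp only: vinner_add vinner_commute[of h "\<lambda>i. a i + b i"] vinner_commute[of h c] vinner_commute[of h d])
  finally show ?thesis by (simp add: vnorm_add_sq vnorm_diff_sq)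
qed

lemma vnorm_diff_commute: "vnorm h (\<lambda>i. x i - y i) = vnorm h (\<lambda>i. y i - x i)"
  using vnorm_uminus[of h "\<lambda>i. x i - y i"] by simp

text \<open>The sides are the vertices below \<open>N\<close> and those from \<open>N\<close> on;
  several vertices may carry the same point. The threshold on a side is twice the one across, which
  balances two inner edges against four crossing ones in the quadrilateral inequality.\<close>

definition point_graph :: "nat \<Rightarrow> nat \<Rightarrow> (nat \<Rightarrow> nat \<Rightarrow> int) \<Rightarrow> real \<Rightarrow> nat set set" where
  "point_graph N h \<phi> t = {{u, v} |u v. u < 2 * N \<and> v < 2 * N \<and> u \<noteq> v \<and>
     (if u < N \<longleftrightarrow> v < N then 2 * t < (vnorm h (\<lambda>i. \<phi> u i - \<phi> v i))\<^sup>2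
      else (vnorm h (\<lambda>i. \<phi> u i - \<phi> v i))\<^sup>2 < t)}"

lemma mem_point_graph:
  "{u, v} \<in> point_graph N h \<phi> t \<longleftrightarrow> u < 2 * N \<and> v < 2 * N \<and> u \<noteq> v \<and>
     (if u < N \<longleftrightarrow> v < N then 2 * t < (vnorm h (\<lambda>i. \<phi> u i - \<phi> v i))\<^sup>2
      else (vnorm h (\<lambda>i. \<phi> u i - \<phi> v i))\<^sup>2 < t)"
  unfolding point_graph_def using vnorm_diff_commute[of h "\<phi> u" "\<phi> v"]
  by (fastforce simp: doubleton_eq_iff)

text \<open>Three squared distances above \<open>2 * t\<close> would sum to more than
  \<open>6 * t \<ge> 9 * r\<^sup>2\<close>, against \<open>vnorm_diff_triangle_sq\<close>.\<close>

lemma point_graph_side_no_triangle: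
  assumes ball: "\<And>v. \<phi> v \<in> lball h r" and t: "3 * r\<^sup>2 \<le> 2 * t"
    and K: "card K = 3" "clique K (point_graph N h \<phi> t)" "K \<subseteq> {..<N} \<or> K \<inter> {..<N} = {}"
  shows False
proof -
  obtain a b c where abc: "K = {a, b, c}" "a \<noteq> b" "b \<noteq> c" "a \<noteq> c" using K(1) by (auto simp: card_3_iff)
  have far: "2 * t < (vnorm h (\<lambda>i. \<phi> u i - \<phi> v i))\<^sup>2" if "u \<in> K" "v \<in> K" "u \<noteq> v" for u v
  proof -
    have "{u, v} \<in> point_graph N h \<phi> t" using K(2) that by (simp add: clique_def)
    moreover have "u < N \<longleftrightarrow> v < N" using K(3) that by auto
    ultimately show ?thesis by (simp add: mem_point_graph)
  qed
  show False
    using far[of a b] far[of b c] far[of a c] abc t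
      vnorm_diff_triangle_sq[OF ball[of a] ball[of b] ball[of c]] by simp
qed

text \<open>Since neither side contains a triangle, four mutually adjacent vertices would split two
  and two, where the quadrilateral inequality gives a contradiction.\<close>

lemma nice_graph_point_graph:
  assumes ball: "\<And>v. \<phi> v \<in> lball h r" and t: "3 * r\<^sup>2 \<le> 2 * t"
  shows "nice_graph {..<2 * N} (point_graph N h \<phi> t)"
  unfolding nice_graph_def
proof (intro conjI exI)
  let ?E = "point_graph N h \<phi> t"
  show "simple_graph {..<2 * N} ?E"
    by (auto simp: simple_graph_def point_graph_def nsets_def card_2_iff)
  have side: False if c3: "3 \<le> card K" and cl: "clique K ?E" and KN: "K \<subseteq> {..<N} \<or> K \<inter> {..<N} = {}" for K
  proof -
    obtain K' where K': "K' \<subseteq> K" "card K' = 3" using c3 by (meson obtain_subset_with_card_n)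
    have "clique K' ?E" using cl K'(1) by (auto simp: clique_def)
    moreover have "K' \<subseteq> {..<N} \<or> K' \<inter> {..<N} = {}" using KN K'(1) by blast
    ultimately show False by (rule point_graph_side_no_triangle[OF ball t K'(2)])
  qed
  show "clique_free 4 {..<2 * N} ?E"
    unfolding clique_free_def
  proof
    assume "\<exists>K\<in>[{..<2 * N}]\<^bsup>4\<^esup>. clique K ?E"
    then obtain K where K: "K \<subseteq> {..<2 * N}" "finite K" "card K = 4" "clique K ?E"
      by (auto simp: nsets_def)
    have "\<not> 3 \<le> card (K \<inter> {..<N})" "\<not> 3 \<le> card (K - {..<N})"
      using side[of "K \<inter> {..<N}"] side[of "K - {..<N}"] K by (auto simp: clique_def)
    moreover have "card (K \<inter> {..<N}) + card (K - {..<N}) = 4"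
      using card_Int_Diff[of K "{..<N}"] K by simp
    ultimately have "card (K \<inter> {..<N}) = 2" "card (K - {..<N}) = 2" by linarith+
    then obtain a b c d where ab: "K \<inter> {..<N} = {a, b}" "a \<noteq> b" and cd: "K - {..<N} = {c, d}" "c \<noteq> d"
      by (auto simp: card_2_iff)
    have "a \<in> K" "b \<in> K" "c \<in> K" "d \<in> K" "a < N" "b < N" "\<not> c < N" "\<not> d < N" using ab cd by auto
    moreover have "{u, v} \<in> ?E" if "u \<in> K" "v \<in> K" "u \<noteq> v" for u v
      using K(4) that by (simp add: clique_def)
    ultimately have "{a, b} \<in> ?E" "{c, d} \<in> ?E" "{a, c} \<in> ?E" "{a, d} \<in> ?E" "{b, c} \<in> ?E" "{b, d} \<in> ?E"
      using ab(2) cd(2) by metis+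
    then show False
      using vnorm_diff_quadrilateral_sq[of h "\<phi> a" "\<phi> b" "\<phi> c" "\<phi> d"]
        \<open>a < N\<close> \<open>b < N\<close> \<open>\<not> c < N\<close> \<open>\<not> d < N\<close> by (simp add: mem_point_graph)
  qed
  show "{..<N} \<union> {N..<2 * N} = {..<2 * N}" "{..<N} \<inter> {N..<2 * N} = {}" by auto
  show "real (card {..<N}) = real (card {..<2 * N}) / 2" "real (card {N..<2 * N}) = real (card {..<2 * N}) / 2"
    by simp_all
  show "clique_free 3 {..<N} (induced_edges ?E {..<N})"
    unfolding clique_free_def
  proof
    assume "\<exists>K\<in>[{..<N}]\<^bsup>3\<^esup>. clique K (induced_edges ?E {..<N})"
    then obtain K where "K \<subseteq> {..<N}" "card K = 3" "clique K ?E"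
      by (auto simp: nsets_def clique_def induced_edges_def)
    then show False using side[of K] by simp
  qed
  show "clique_free 3 {N..<2 * N} (induced_edges ?E {N..<2 * N})"
    unfolding clique_free_def
  proof
    assume "\<exists>K\<in>[{N..<2 * N}]\<^bsup>3\<^esup>. clique K (induced_edges ?E {N..<2 * N})"
    then obtain K where "K \<subseteq> {N..<2 * N}" "card K = 3" "clique K ?E"
      by (auto simp: nsets_def clique_def induced_edges_def)
    then show False using side[of K] by fastforce
  qed
qed

section \<open>Independence number and minimum degree\<close>

lemma independence_number_le:
  assumes "finite V" and "\<And>S. S \<subseteq> V \<Longrightarrow> indep S E \<Longrightarrow> real (card S) \<le> b"
  shows "real (independence_number V E) \<le> b"
proof -
  let ?I = "{S. S \<subseteq> V \<and> indep S E}"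
  have "finite ?I" using assms(1) by simp
  moreover have "{} \<in> ?I" by (simp add: indep_def)
  ultimately have "Max (card ` ?I) \<in> card ` ?I" by (intro Max_in) auto
  then show ?thesis using assms(2) by (auto simp: independence_number_def)
qed

lemma min_degree_ge:
  assumes "finite V" "V \<noteq> {}" and "\<And>v. v \<in> V \<Longrightarrow> b \<le> real (vertex_degree E v)"
  shows "b \<le> real (min_degree V E)"
proof -
  have "Min (vertex_degree E ` V) \<in> vertex_degree E ` V" using assms by (intro Min_in) auto
  then show ?thesis using assms(3) by (auto simp: min_degree_def)
qed

lemma card_le_vertex_degree:
  assumes "finite E" and "\<And>u. u \<in> T \<Longrightarrow> {u, v} \<in> E"
  shows "card T \<le> vertex_degree E v"
  unfolding vertex_degree_def
proof (rule card_inj_on_le[where f = "\<lambda>u. {u, v}"])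
  show "inj_on (\<lambda>u. {u, v}) T" by (auto simp: inj_on_def doubleton_eq_iff)
qed (use assms in auto)

text \<open>Separates the combinatorics from the geometry: with \<open>q = N div card P\<close>,
  each point serves \<open>q\<close> or \<open>q + 1\<close> vertices per side. An independent set
  has at most \<open>(q + 1) * \<alpha>\<close> vertices on each side, and degrees are bounded below
  by crossing edges alone.\<close>

lemma exists_graph_of_points:
  assumes P: "finite P" "P \<noteq> {}" "P \<subseteq> lball h r" and N: "0 < N" and t: "3 * r\<^sup>2 \<le> 2 * t"
    and indep: "\<And>A. A \<subseteq> P \<Longrightarrow> (\<And>a b. a \<in> A \<Longrightarrow> b \<in> A \<Longrightarrow> (vnorm h (\<lambda>i. a i - b i))\<^sup>2 \<le> 2 * t) \<Longrightarrow>
        real (card A) \<le> \<alpha>"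
    and deg: "\<And>x. x \<in> P \<Longrightarrow> \<delta> \<le> real (card {y \<in> P. (vnorm h (\<lambda>i. x i - y i))\<^sup>2 < t})"
  obtains E where "nice_graph {..<2 * N} E"
    and "real (independence_number {..<2 * N} E) \<le> 2 * (real (N div card P) + 1) * \<alpha>"
    and "real (N div card P) * \<delta> \<le> real (min_degree {..<2 * N} E)"
proof -
  define q where "q = N div card P"
  obtain \<psi> :: "nat \<Rightarrow> nat \<Rightarrow> int" where \<psi>: "\<And>v. \<psi> v \<in> P"
    and lower: "\<And>A. A \<subseteq> P \<Longrightarrow> q * card A \<le> card {v. v < N \<and> \<psi> v \<in> A}"
    and upper: "\<And>A. A \<subseteq> P \<Longrightarrow> card {v. v < N \<and> \<psi> v \<in> A} \<le> (q + 1) * card A"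
    unfolding q_def using exists_balanced_map[OF P(1,2), of N] by blast
  \<comment> \<open>Both sides carry the same assignment of points.\<close>
  define \<phi> where "\<phi> = (\<lambda>v. \<psi> (v mod N))"
  have \<phi>: "\<phi> v \<in> P" for v using \<psi> by (simp add: \<phi>_def)
  define E where "E = point_graph N h \<phi> t"
  have t0: "0 \<le> t" using t zero_le_power2[of r] by linarith
  have nice: "nice_graph {..<2 * N} E"
    unfolding E_def using \<phi> P(3) t by (intro nice_graph_point_graph) auto
  have finE: "finite E"
  proof (rule finite_subset)
    show "E \<subseteq> Pow {..<2 * N}" by (auto simp: E_def point_graph_def)
  qed simp
  have half: "real (card S) \<le> (real q + 1) * \<alpha>"
    if S: "S \<subseteq> {..<2 * N}" "indep S E" "S \<subseteq> {..<N} \<or> S \<inter> {..<N} = {}" for S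
  proof -
    define A where "A = \<phi> ` S"
    have "real (card A) \<le> \<alpha>"
    proof (rule indep)
      show "A \<subseteq> P" using \<phi> by (auto simp: A_def)
      fix a b assume "a \<in> A" "b \<in> A"
      then obtain u v where uv: "u \<in> S" "v \<in> S" "a = \<phi> u" "b = \<phi> v" by (auto simp: A_def)
      show "(vnorm h (\<lambda>i. a i - b i))\<^sup>2 \<le> 2 * t"
      proof (cases "u = v")
        case True
        then show ?thesis using uv t0 by (simp add: vnorm_def L2_set_def)
      next
        case False
        then have "{u, v} \<notin> E" using S(2) uv by (simp add: indep_def)
        moreover have "u < 2 * N" "v < 2 * N" "u < N \<longleftrightarrow> v < N" using S uv by auto
        ultimately show ?thesis using False uv by (simp add: E_def mem_point_graph)
      qed
    qed
    have inj: "inj_on (\<lambda>v. v mod N) S"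
    proof (rule inj_onI)
      fix u v assume uv: "u \<in> S" "v \<in> S" "u mod N = v mod N"
      have "u div N = v div N"
      proof (cases "S \<subseteq> {..<N}")
        case True
        then have "u < N" "v < N" using uv by auto
        then show ?thesis by simp
      next
        case False
        then have "N \<le> u" "N \<le> v" "u < 2 * N" "v < 2 * N" using S uv by fastforce+
        then have "u div N = 1" "v div N = 1" by (auto intro!: div_nat_eqI)
        then show ?thesis by simp
      qed
      then show "u = v" using uv(3) by (metis div_mult_mod_eq)
    qed
    have "(\<lambda>v. v mod N) ` S \<subseteq> {v. v < N \<and> \<psi> v \<in> A}" using N by (auto simp: A_def \<phi>_def)
    then have "card ((\<lambda>v. v mod N) ` S) \<le> card {v. v < N \<and> \<psi> v \<in> A}" by (intro card_mono) auto
    also have "\<dots> \<le> (q + 1) * card A" using \<phi> by (intro upper) (auto simp: A_def)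
    finally have "card S \<le> (q + 1) * card A" by (simp add: card_image[OF inj])
    then have "real (card S) \<le> (real q + 1) * real (card A)"
      by (metis of_nat_1 of_nat_add of_nat_le_iff of_nat_mult)
    also have "\<dots> \<le> (real q + 1) * \<alpha>" using \<open>real (card A) \<le> \<alpha>\<close> by (intro mult_left_mono) auto
    finally show ?thesis .
  qed
  have "real (independence_number {..<2 * N} E) \<le> 2 * (real q + 1) * \<alpha>"
  proof (rule independence_number_le)
    fix S assume S: "S \<subseteq> {..<2 * N}" "indep S E"
    have "real (card (S \<inter> {..<N})) \<le> (real q + 1) * \<alpha>" "real (card (S - {..<N})) \<le> (real q + 1) * \<alpha>"
      using S by (intro half; auto simp: indep_def)+
    moreover have "card S = card (S \<inter> {..<N}) + card (S - {..<N})"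
      using S(1) finite_subset by (intro card_Int_Diff) blast
    ultimately show "real (card S) \<le> 2 * (real q + 1) * \<alpha>" by linarith
  qed simp
  moreover have "real q * \<delta> \<le> real (min_degree {..<2 * N} E)"
  proof (rule min_degree_ge)
    fix v assume v: "v \<in> {..<2 * N}"
    define A where "A = {y \<in> P. (vnorm h (\<lambda>i. \<phi> v i - y i))\<^sup>2 < t}"
    \<comment> \<open>The shift that moves indices below \<open>N\<close> to the side opposite
      \<open>v\<close>.\<close>
    define s where "s = (if v < N then N else 0)"
    define T where "T = (\<lambda>w. w + s) ` {w. w < N \<and> \<psi> w \<in> A}"
    have "card T \<le> vertex_degree E v"
    proof (rule card_le_vertex_degree[OF finE])
      fix u assume "u \<in> T"
      then obtain w where w: "w < N" "\<psi> w \<in> A" "u = w + s" by (auto simp: T_def)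
      have "\<phi> u = \<psi> w" using w by (simp add: \<phi>_def s_def)
      then have "(vnorm h (\<lambda>i. \<phi> v i - \<phi> u i))\<^sup>2 < t" using w(2) by (simp add: A_def)
      moreover have "u < 2 * N" "u < N \<longleftrightarrow> \<not> v < N" using w v by (auto simp: s_def)
      ultimately have "{v, u} \<in> E" using v by (auto simp: E_def mem_point_graph)
      then show "{u, v} \<in> E" by (simp add: insert_commute)
    qed
    moreover have "card T = card {w. w < N \<and> \<psi> w \<in> A}" unfolding T_def by (simp add: card_image)
    moreover have "q * card A \<le> card {w. w < N \<and> \<psi> w \<in> A}" by (rule lower) (auto simp: A_def)
    ultimately have "real (q * card A) \<le> real (vertex_degree E v)" by (simp only: of_nat_le_iff)
    moreover have "real q * \<delta> \<le> real q * real (card A)"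
      using deg[OF \<phi>[of v]] unfolding A_def by (intro mult_left_mono) auto
    ultimately show "real q * \<delta> \<le> real (vertex_degree E v)" by simp
  qed (use N in \<open>auto simp: lessThan_empty_iff\<close>)
  ultimately show ?thesis using nice that unfolding q_def by blast
qed

theorem theorem8p1:
  shows "\<exists>C::real. C > 0 \<and>
    (\<forall>(\<epsilon>::real) (h::nat) (n::nat).
       0 < \<epsilon> \<and> \<epsilon> < 1 \<and> 16 \<le> h \<and> even n \<and>
       real n \<ge> (C * sqrt (real h) / \<epsilon>) ^ h \<longrightarrow>
       (\<exists>(V::nat set) (E::nat set set).
          nice_graph V E \<and> card V = n \<and>
          real (independence_number V E) \<le> 2 * real n * exp (- (\<epsilon> * sqrt (real h) / 4)) \<and>
          real (min_degree V E) \<ge> (1 / 4 - 2 * \<epsilon>) * real n))"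
proof (intro exI[of _ 10000] conjI allI impI)
  fix \<epsilon> :: real and h n :: nat
  assume H: "0 < \<epsilon> \<and> \<epsilon> < 1 \<and> 16 \<le> h \<and> even n \<and> real n \<ge> (10000 * sqrt (real h) / \<epsilon>) ^ h"
  then have \<epsilon>: "0 < \<epsilon>" "\<epsilon> < 1" and h: "16 \<le> h" and big: "(10000 * sqrt (real h) / \<epsilon>) ^ h \<le> real n"
    by auto
  define N where "N = n div 2"
  have n: "n = 2 * N" using H by (simp add: N_def)
  have s1: "1 \<le> sqrt (real h)" using h by simp
  have "0 < (10000 * sqrt (real h) / \<epsilon>) ^ h" using \<epsilon> s1 by (intro zero_less_power divide_pos_pos) auto
  then have N: "0 < N" using big n by (cases N) auto
  show "\<exists>(V::nat set) (E::nat set set).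
          nice_graph V E \<and> card V = n \<and>
          real (independence_number V E) \<le> 2 * real n * exp (- (\<epsilon> * sqrt (real h) / 4)) \<and>
          real (min_degree V E) \<ge> (1 / 4 - 2 * \<epsilon>) * real n"
  \<comment> \<open>The factor \<open>2 * exp (- (\<epsilon> * sqrt h / 4))\<close> is at least 1
    exactly in the first case. In the second, \<open>\<epsilon> * sqrt h \<ge> 8 / 3\<close>, which
    later absorbs the rounding in the degree bound.\<close>
  proof (cases "\<epsilon> * sqrt (real h) / 4 \<le> ln 2")
    case True
    \<comment> \<open>The bound on the independence number is vacuous, and the complete bipartite graph will do.\<close>
    have P: "{\<lambda>_. 0} \<subseteq> lball 0 0" by (simp add: lball_def int_vecs_def vnorm_def)
    obtain E where E: "nice_graph {..<2 * N} E"
      "real (N div card {\<lambda>_::nat. 0::int}) * 1 \<le> real (min_degree {..<2 * N} E)"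
    \<comment> \<open>All vertices carry the single point of dimension 0, so all distances vanish:
      every crossing pair is joined and no pair on one side is.\<close>
    proof (rule exists_graph_of_points[OF _ _ P N, where t = 1 and \<alpha> = 1 and \<delta> = 1])
      show "real (card A) \<le> 1" if "A \<subseteq> {\<lambda>_::nat. 0::int}" for A
        using card_mono[OF _ that] by simp
      show "1 \<le> real (card {y \<in> {\<lambda>_. 0}. (vnorm 0 (\<lambda>i. x i - y i))\<^sup>2 < 1})" for x
      proof -
        have "{y \<in> {\<lambda>_. 0}. (vnorm 0 (\<lambda>i. x i - y i))\<^sup>2 < 1} = {\<lambda>_. 0}" by (auto simp: vnorm_def)
        then show ?thesis by simp
      qed
    qed auto
    have "exp (- ln 2) \<le> exp (- (\<epsilon> * sqrt (real h) / 4))" using True by simp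
    then have "1 \<le> 2 * exp (- (\<epsilon> * sqrt (real h) / 4))" by (simp add: exp_minus)
    then have "real n * 1 \<le> real n * (2 * exp (- (\<epsilon> * sqrt (real h) / 4)))" by (intro mult_left_mono) auto
    moreover have "real (independence_number {..<2 * N} E) \<le> real n"
      unfolding n by (rule independence_number_le) (auto dest: card_mono[rotated])
    moreover have "(1 / 4 - 2 * \<epsilon>) * real n \<le> 1 / 2 * real n" using \<epsilon> by (intro mult_right_mono) auto
    ultimately show ?thesis using E n by (intro exI[of _ "{..<2 * N}"] exI[of _ E]) auto
  next
    case False
    define \<mu> where "\<mu> = \<epsilon> / sqrt (real h)"
    have "sqrt (4\<^sup>2) \<le> sqrt (real h)" using h by (intro real_sqrt_le_mono) simp
    then have \<mu>: "\<mu> \<le> 1 / 4" unfolding \<mu>_def using \<epsilon> by (intro frac_le) auto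
    define x where "x = exp (- (\<epsilon> * sqrt (real h) / 4))"
    from exists_good_radius[OF \<epsilon> h] obtain r where r: "0 < r"
      and K: "real (card (lball h r)) \<le> (2460 * sqrt (real h) / \<epsilon>) ^ h"
      and ind: "\<And>A. A \<subseteq> lball h r \<Longrightarrow>
        (\<And>a b. a \<in> A \<Longrightarrow> b \<in> A \<Longrightarrow> (vnorm h (\<lambda>i. a i - b i))\<^sup>2 \<le> 4 * (1 - \<mu>) * r\<^sup>2) \<Longrightarrow>
        real (card A) \<le> real (card (lball h r)) * x"
      and deg: "\<And>x. \<epsilon> < 1 / 8 \<Longrightarrow> x \<in> lball h r \<Longrightarrow> (1 - 6 * \<epsilon>) / 2 * real (card (lball h r))
        \<le> real (card {y \<in> lball h r. (vnorm h (\<lambda>i. x i - y i))\<^sup>2 < 2 * (1 - \<mu>) * r\<^sup>2})"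
      unfolding \<mu>_def x_def by blast
    have tt: "2 * (2 * (1 - \<mu>) * r\<^sup>2) = 4 * (1 - \<mu>) * r\<^sup>2" by (simp add: algebra_simps)
    define k where "k = card (lball h r)"
    have k0: "0 < k" unfolding k_def using r by (simp add: card_lball_pos)
    define q where "q = N div k"
    \<comment> \<open>For \<open>\<epsilon> \<ge> 1 / 8\<close> the required degree
      \<open>(1 / 4 - 2 * \<epsilon>) * n\<close> is not positive, so 0 suffices.\<close>
    define \<delta> where "\<delta> = (if \<epsilon> < 1 / 8 then (1 - 6 * \<epsilon>) / 2 * real k else 0)"
    obtain E where E: "nice_graph {..<2 * N} E"
      "real (independence_number {..<2 * N} E) \<le> 2 * (real q + 1) * (real k * x)"
      "real q * \<delta> \<le> real (min_degree {..<2 * N} E)"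
    proof (rule exists_graph_of_points[where P = "lball h r" and h = h and r = r and N = N
          and t = "2 * (1 - \<mu>) * r\<^sup>2" and \<alpha> = "real k * x" and \<delta> = \<delta>])
      show "lball h r \<noteq> {}" using k0 by (auto simp: k_def)
      have "3 * r\<^sup>2 \<le> 4 * (1 - \<mu>) * r\<^sup>2" using \<mu> by (intro mult_right_mono) auto
      then show "3 * r\<^sup>2 \<le> 2 * (2 * (1 - \<mu>) * r\<^sup>2)" unfolding tt .
      show "real (card A) \<le> real k * x" if "A \<subseteq> lball h r"
        "\<And>a b. a \<in> A \<Longrightarrow> b \<in> A \<Longrightarrow> (vnorm h (\<lambda>i. a i - b i))\<^sup>2 \<le> 2 * (2 * (1 - \<mu>) * r\<^sup>2)" for A
        unfolding k_def using that unfolding tt by (rule ind)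
      show "\<delta> \<le> real (card {y \<in> lball h r. (vnorm h (\<lambda>i. x i - y i))\<^sup>2 < 2 * (1 - \<mu>) * r\<^sup>2})"
        if "x \<in> lball h r" for x
        using deg[OF _ that] by (simp add: \<delta>_def k_def)
    qed (use N finite_lball in \<open>auto simp: q_def k_def\<close>)
    \<comment> \<open>The constant 10000 exceeds \<open>4 * 2460\<close>, so \<open>n\<close> is at
      least \<open>4 ^ h\<close> times the number of lattice points.\<close>
    have "2 ^ h \<le> q"
    proof -
      have "4 ^ h * real k \<le> 4 ^ h * (2460 * sqrt (real h) / \<epsilon>) ^ h" using K by (simp add: k_def)
      also have "\<dots> = (4 * (2460 * sqrt (real h) / \<epsilon>)) ^ h" by (simp only: power_mult_distrib)
      also have "\<dots> \<le> (10000 * sqrt (real h) / \<epsilon>) ^ h"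
        using \<epsilon> s1 by (intro power_mono) (auto simp: divide_right_mono)
      finally have "real (4 ^ h * k) \<le> real n" using big by simp
      then have "4 ^ h * k \<le> 2 * N" using n by (simp only: of_nat_le_iff)
      moreover have "2 * 2 ^ h \<le> (4::nat) ^ h"
      proof -
        have "(2::nat) ^ Suc h \<le> 2 ^ (2 * h)" using h by (intro power_increasing) auto
        then show ?thesis by (simp add: power_mult)
      qed
      then have "2 * 2 ^ h * k \<le> 4 ^ h * k" by (rule mult_le_mono1)
      ultimately have "2 ^ h * k \<le> N" by linarith
      then show ?thesis unfolding q_def using k0 by (simp add: less_eq_div_iff_mult_less_eq)
    qed
    then have hq: "h \<le> q" using less_exp[of h] by linarith
    have qk: "q * k \<le> N" "N \<le> (q + 1) * k"
      unfolding q_def using k0 dividend_less_div_times[of k N] by (auto simp: mult.commute)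
    have "real (independence_number {..<2 * N} E) \<le> 2 * real n * x"
    proof -
      \<comment> \<open>Rounding up at most doubles the count:
        \<open>(q + 1) * k \<le> 2 * N = n\<close>.\<close>
      have "1 * k \<le> q * k" using hq h by (intro mult_le_mono1) linarith
      then have "(q + 1) * k \<le> 2 * N" using qk(1) unfolding add_mult_distrib by linarith
      then have "real ((q + 1) * k) \<le> real (2 * N)" by (simp only: of_nat_le_iff)
      then have "2 * (real q + 1) * real k * x \<le> 2 * real (2 * N) * x"
        by (intro mult_right_mono) (auto simp: x_def algebra_simps)
      then show ?thesis using E(2) n by (simp add: mult.assoc)
    qed
    moreover have "(1 / 4 - 2 * \<epsilon>) * real n \<le> real (min_degree {..<2 * N} E)"
    proof (cases "\<epsilon> < 1 / 8")
      case True
      have "2 / 3 \<le> \<epsilon> * sqrt (real h) / 4" using False ln2_ge_two_thirds by linarith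
      moreover have "sqrt (real h) \<le> real h" using real_le_lsqrt[of "real h" "real h"] h
        by (simp add: power2_eq_square)
      then have "\<epsilon> * sqrt (real h) \<le> \<epsilon> * real q" using hq \<epsilon> by (intro mult_left_mono) auto
      ultimately have "1 / 2 \<le> \<epsilon> * real q" by linarith
      \<comment> \<open>The difference of the two sides is
        \<open>\<epsilon> * q + 4 * \<epsilon> - 1 / 2\<close>: the slack between
        \<open>3 * \<epsilon>\<close> and \<open>4 * \<epsilon>\<close> pays for replacing
        \<open>q\<close> by \<open>q + 1\<close>.\<close>
      then have "(1 / 2 - 4 * \<epsilon>) * (real q + 1) \<le> real q * ((1 - 6 * \<epsilon>) / 2)"
        using \<epsilon> by (simp add: algebra_simps)
      then have "(1 / 2 - 4 * \<epsilon>) * (real q + 1) * real k \<le> real q * ((1 - 6 * \<epsilon>) / 2) * real k"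
        by (intro mult_right_mono) auto
      moreover have "real N \<le> real ((q + 1) * k)" using qk(2) by (simp only: of_nat_le_iff)
      then have "(1 / 2 - 4 * \<epsilon>) * real N \<le> (1 / 2 - 4 * \<epsilon>) * ((real q + 1) * real k)"
        using True by (intro mult_left_mono) (auto simp: distrib_right)
      moreover have "(1 / 4 - 2 * \<epsilon>) * real n = (1 / 2 - 4 * \<epsilon>) * real N" unfolding n by (simp add: algebra_simps)
      moreover have "real q * \<delta> = real q * ((1 - 6 * \<epsilon>) / 2) * real k" using True by (simp add: \<delta>_def)
      ultimately show ?thesis using E(3) unfolding mult.assoc by linarith
    next
      case False
      then have "(1 / 4 - 2 * \<epsilon>) * real n \<le> 0" by (simp add: mult_nonpos_nonneg)
      also have "0 \<le> real (min_degree {..<2 * N} E)" by simp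
      finally show ?thesis .
    qed
    ultimately show ?thesis using E(1) n unfolding x_def by (intro exI[of _ "{..<2 * N}"] exI[of _ E]) auto
  qed
qed simp

end
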